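(* Let $\mathbf{G}$ be a finite group considered in the signature $\{\cdot\}$. Then the flat extension $\flat(\mathbf{G})$ (in the signature $\{\cdot,\wedge\}$) is an additive idempotent semiring, with $\wedge$ as addition and $\cdot$ as multiplication; and if $\mathbf{G}$ has a nonabelian Sylow subgroup, then the equational complexity function of $\flat(\mathbf{G})$ satisfies $\beta_{\flat(\mathbf{G})}(n)\in O\big((\log_2 n)^3\big)$.
   Context: For a group $\mathbf{G}=\langle G;\cdot\rangle$ and a symbol $0\notin G$, the flat extension $\flat(\mathbf{G})$ is the algebra $\langle G\cup\{0\};\cdot,\wedge\rangle$ in which $\cdot$ is extended from $G$ by making $0$ an absorbing element ($x\cdot 0=0\cdot x=0$), and $x\wedge y=x$ if $x=y$ and $x\wedge y=0$ otherwise. An additive idempotent semiring is an algebra with two binary operations, addition and multiplication, such that addition is associative, commutative and idempotent, multiplication is associative, and multiplication distributes over addition on both sides (no constants are required). The length of an equation $\mathbf{u}\approx\mathbf{v}$ is the number of symbols (variables and operation symbols) in the concatenation of the bracket-free prefix expressions of the terms $\mathbf{u}$ and $\mathbf{v}$. For a finite algebra $\mathbf{A}$ of finite signature, with $\mathbb{V}(\mathbf{A})$ denoting the variety generated by $\mathbf{A}$, the equational complexity function $\beta_{\mathbf{A}}$ is defined by letting $\beta_{\mathbf{A}}(n)$ be the smallest number $\ell$ such that for every algebra $\mathbf{B}$ (of the same signature) with fewer than $n$ elements, if $\mathbf{B}\notin\mathbb{V}(\mathbf{A})$ then there is an equation true in $\mathbf{A}$, failing on $\mathbf{B}$, and of length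 at most $\ell$. *)

theory Defs
  imports Complex_Main "HOL-Algebra.Group" "HOL-Algebra.Coset" "HOL-Computational_Algebra.Primes"
    "HOL-Library.FuncSet" "HOL-Library.Landau_Symbols"
begin

section \<open>Algebras with two binary operations\<close>

record 'a sr_alg = "'a partial_object" +
  sr_mult :: "'a \<Rightarrow> 'a \<Rightarrow> 'a"
  sr_meet :: "'a \<Rightarrow> 'a \<Rightarrow> 'a"

definition is_alg :: "'a sr_alg \<Rightarrow> bool" where
  "is_alg A \<longleftrightarrow> carrier A \<noteq> {} \<and>
     (\<forall>x\<in>carrier A. \<forall>y\<in>carrier A.
        sr_mult A x y \<in> carrier A \<and> sr_meet A x y \<in> carrier A)"

definition additive_idempotent_semiring :: "'a sr_alg \<Rightarrow> bool" where
  "additive_idempotent_semiring A \<longleftrightarrow> is_alg A \<and>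
     (\<forall>x\<in>carrier A. sr_meet A x x = x) \<and>
     (\<forall>x\<in>carrier A. \<forall>y\<in>carrier A. sr_meet A x y = sr_meet A y x) \<and>
     (\<forall>x\<in>carrier A. \<forall>y\<in>carrier A. \<forall>z\<in>carrier A.
        sr_meet A (sr_meet A x y) z = sr_meet A x (sr_meet A y z) \<and>
        sr_mult A (sr_mult A x y) z = sr_mult A x (sr_mult A y z) \<and>
        sr_mult A x (sr_meet A y z) = sr_meet A (sr_mult A x y) (sr_mult A x z) \<and>
        sr_mult A (sr_meet A x y) z = sr_meet A (sr_mult A x z) (sr_mult A y z))"

section \<open>Flat extensions and Sylow subgroups\<close>

text \<open>The absorbing element \<open>0\<close> is \<^const>\<open>None\<close>.\<close>

definition flat_extension :: "('a, 'm) monoid_scheme \<Rightarrow> 'a option sr_alg" where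
  "flat_extension G =
    \<lparr>carrier = insert None (Some ` carrier G),
     sr_mult = (\<lambda>x y. case (x, y) of (Some a, Some b) \<Rightarrow> Some (a \<otimes>\<^bsub>G\<^esub> b) | _ \<Rightarrow> None),
     sr_meet = (\<lambda>x y. if x = y then x else None)\<rparr>"

definition sylow_subgroup :: "nat \<Rightarrow> 'a set \<Rightarrow> ('a, 'm) monoid_scheme \<Rightarrow> bool" where
  "sylow_subgroup p P G \<longleftrightarrow>
     prime p \<and> subgroup P G \<and> card P = p ^ multiplicity p (order G)"

section \<open>Terms and equations\<close>

datatype 'v sr_term =
    Var 'v
  | Mult "'v sr_term" "'v sr_term"
  | Meet "'v sr_term" "'v sr_term"

primrec eval_term :: "'a sr_alg \<Rightarrow> ('v \<Rightarrow> 'a) \<Rightarrow> 'v sr_term \<Rightarrow> 'a" where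
  "eval_term A e (Var x) = e x"
| "eval_term A e (Mult s t) = sr_mult A (eval_term A e s) (eval_term A e t)"
| "eval_term A e (Meet s t) = sr_meet A (eval_term A e s) (eval_term A e t)"

definition satisfies :: "'a sr_alg \<Rightarrow> 'v sr_term \<Rightarrow> 'v sr_term \<Rightarrow> bool" where
  "satisfies A u v \<longleftrightarrow>
     (\<forall>e. range e \<subseteq> carrier A \<longrightarrow> eval_term A e u = eval_term A e v)"

primrec term_length :: "'v sr_term \<Rightarrow> nat" where
  "term_length (Var x) = 1"
| "term_length (Mult s t) = 1 + term_length s + term_length t"
| "term_length (Meet s t) = 1 + term_length s + term_length t"

definition equation_length :: "'v sr_term \<Rightarrow> 'v sr_term \<Rightarrow> nat" where
  "equation_length u v = term_length u + term_length v"

section \<open>The variety generated by an algebra\<close>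

definition power_alg :: "'i set \<Rightarrow> 'a sr_alg \<Rightarrow> ('i \<Rightarrow> 'a) sr_alg" where
  "power_alg I A =
    \<lparr>carrier = I \<rightarrow>\<^sub>E carrier A,
     sr_mult = (\<lambda>f g. \<lambda>i\<in>I. sr_mult A (f i) (g i)),
     sr_meet = (\<lambda>f g. \<lambda>i\<in>I. sr_meet A (f i) (g i))\<rparr>"

definition subalgebra :: "'a sr_alg \<Rightarrow> 'a sr_alg \<Rightarrow> bool" where
  "subalgebra S A \<longleftrightarrow> is_alg S \<and> carrier S \<subseteq> carrier A \<and>
     sr_mult S = sr_mult A \<and> sr_meet S = sr_meet A"

definition alg_hom :: "'a sr_alg \<Rightarrow> 'b sr_alg \<Rightarrow> ('a \<Rightarrow> 'b) set" where
  "alg_hom A B = {h \<in> carrier A \<rightarrow> carrier B. \<forall>x\<in>carrier A. \<forall>y\<in>carrier A.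
     h (sr_mult A x y) = sr_mult B (h x) (h y) \<and>
     h (sr_meet A x y) = sr_meet B (h x) (h y)}"

definition in_HSP :: "'i set \<Rightarrow> 'a sr_alg \<Rightarrow> 'b sr_alg \<Rightarrow> bool" where
  "in_HSP I A B \<longleftrightarrow> is_alg B \<and>
     (\<exists>S h. subalgebra S (power_alg I A) \<and> h \<in> alg_hom S B \<and> h ` carrier S = carrier B)"

text \<open>The variety generated by \<open>A\<close> consists of the homomorphic images of subalgebras of
  powers of \<open>A\<close>. HOL has no quantification over the type of the index set, but lemma
  \<open>in_HSP_imp_in_variety\<close> below shows that index sets in the type \<^typ>\<open>'b \<Rightarrow> 'a\<close>
  yield the same algebras as index sets in any other type.\<close>

definition in_variety :: "'a sr_alg \<Rightarrow> 'b sr_alg \<Rightarrow> bool" where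
  "in_variety A B \<longleftrightarrow> (\<exists>I :: ('b \<Rightarrow> 'a) set. in_HSP I A B)"

lemma eval_term_closed:
  assumes "is_alg A" "\<And>x. x \<in> set_sr_term t \<Longrightarrow> e x \<in> carrier A"
  shows "eval_term A e t \<in> carrier A"
  using assms by (induction t) (auto simp: is_alg_def)

lemma eval_term_power:
  assumes "i \<in> I"
  shows "eval_term (power_alg I A) e t i = eval_term A (\<lambda>x. e x i) t"
  using assms by (induction t) (auto simp: power_alg_def)

lemma eval_term_hom:
  assumes "is_alg A" "h \<in> alg_hom A B" "\<And>x. x \<in> set_sr_term t \<Longrightarrow> e x \<in> carrier A"
  shows "h (eval_term A e t) = eval_term B (\<lambda>x. h (e x)) t"
  using assms(3)
proof (induction t)
  case (Mult s t)
  then show ?case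
    using assms(1,2) eval_term_closed[OF assms(1), of s e] eval_term_closed[OF assms(1), of t e]
    by (auto simp: alg_hom_def)
next
  case (Meet s t)
  then show ?case
    using assms(1,2) eval_term_closed[OF assms(1), of s e] eval_term_closed[OF assms(1), of t e]
    by (auto simp: alg_hom_def)
qed auto

lemma eval_term_cong:
  assumes "sr_mult A = sr_mult A'" "sr_meet A = sr_meet A'"
    "\<And>x. x \<in> set_sr_term t \<Longrightarrow> e x = e' x"
  shows "eval_term A e t = eval_term A' e' t"
  using assms by (induction t) auto

lemma in_HSP_imp_in_variety:
  fixes A :: "'a sr_alg" and B :: "'b sr_alg" and I :: "'i set"
  assumes A: "is_alg A" and B: "in_HSP I A B"
  shows "in_variety A B"
proof -
  obtain S h where S: "subalgebra S (power_alg I A)" and h: "h \<in> alg_hom S B"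
    and surj: "h ` carrier S = carrier B" and algB: "is_alg B"
    using B unfolding in_HSP_def by blast
  have algS: "is_alg S" and Sc: "carrier S \<subseteq> I \<rightarrow>\<^sub>E carrier A"
    and Sm: "sr_mult S = sr_mult (power_alg I A)" "sr_meet S = sr_meet (power_alg I A)"
    using S by (auto simp: subalgebra_def power_alg_def)
  have "\<forall>b\<in>carrier B. \<exists>s\<in>carrier S. h s = b" using surj by (metis imageE)
  then obtain g where g: "\<And>b. b \<in> carrier B \<Longrightarrow> g b \<in> carrier S \<and> h (g b) = b"
    by metis
  define J where "J = (carrier B \<rightarrow>\<^sub>E carrier A)"
  define T where "T = {t. set_sr_term t \<subseteq> carrier B}"
  define F where "F t = (\<lambda>e\<in>J. eval_term A e t)" for t
  define P where "P = power_alg J A"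
  have evS: "h (eval_term S g t) = eval_term B id t" if "t \<in> T" for t
  proof -
    have "h (eval_term S g t) = eval_term B (\<lambda>x. h (g x)) t"
      using that g by (intro eval_term_hom[OF algS h]) (auto simp: T_def)
    also have "\<dots> = eval_term B id t"
      using that g by (intro eval_term_cong) (auto simp: T_def)
    finally show ?thesis .
  qed
  have key: "eval_term B id s = eval_term B id t" if st: "s \<in> T" "t \<in> T" "F s = F t" for s t
  proof -
    have in_S: "eval_term S g r \<in> carrier S" if "r \<in> T" for r
      using that g by (intro eval_term_closed[OF algS]) (auto simp: T_def)
    have "eval_term S g s i = eval_term S g t i" if i: "i \<in> I" for i
    proof -
      define e where "e = (\<lambda>b\<in>carrier B. g b i)"
      have e: "e \<in> J" using g Sc i by (auto simp: e_def J_def PiE_iff subset_iff)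
      have *: "eval_term S g r i = F r e" if "r \<in> T" for r
      proof -
        have "eval_term S g r = eval_term (power_alg I A) g r"
          by (intro eval_term_cong) (auto simp: Sm)
        then have "eval_term S g r i = eval_term A (\<lambda>x. g x i) r"
          using eval_term_power[OF i] by metis
        also have "\<dots> = eval_term A e r"
          using that by (intro eval_term_cong) (auto simp: e_def T_def)
        also have "\<dots> = F r e" using e by (simp add: F_def)
        finally show ?thesis .
      qed
      show ?thesis using *[OF st(1)] *[OF st(2)] st(3) by simp
    qed
    then have "eval_term S g s = eval_term S g t"
      using in_S[OF st(1)] in_S[OF st(2)] Sc by (meson PiE_ext subsetD)
    then show ?thesis using evS[OF st(1)] evS[OF st(2)] by simp
  qed
  define S' where "S' = \<lparr>carrier = F ` T, sr_mult = sr_mult P, sr_meet = sr_meet P\<rparr>"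
  define k where "k f = eval_term B id (SOME t. t \<in> T \<and> F t = f)" for f
  have k: "k (F t) = eval_term B id t" if "t \<in> T" for t
  proof -
    have "(SOME s. s \<in> T \<and> F s = F t) \<in> T \<and> F (SOME s. s \<in> T \<and> F s = F t) = F t"
      by (rule someI[where x = t]) (use that in simp)
    then show ?thesis unfolding k_def using key that by blast
  qed
  have Fm: "sr_mult P (F s) (F t) = F (Mult s t)" "sr_meet P (F s) (F t) = F (Meet s t)" for s t
    by (auto simp: P_def power_alg_def F_def)
  have Tm: "Mult s t \<in> T" "Meet s t \<in> T" if "s \<in> T" "t \<in> T" for s t
    using that by (auto simp: T_def)
  have Tv: "Var b \<in> T" if "b \<in> carrier B" for b
    using that by (auto simp: T_def)
  have ne: "T \<noteq> {}" using algB Tv by (auto simp: is_alg_def)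
  have "F t \<in> carrier P" if "t \<in> T" for t
    using that eval_term_closed[OF A, of t]
    by (auto simp: P_def power_alg_def F_def J_def T_def PiE_iff subset_iff)
  then have sub: "subalgebra S' P"
    using ne Tm by (auto simp: subalgebra_def S'_def is_alg_def Fm)
  have kB: "eval_term B id t \<in> carrier B" if "t \<in> T" for t
    using that by (intro eval_term_closed[OF algB]) (auto simp: T_def)
  have hom: "k \<in> alg_hom S' B"
    using kB by (auto simp: alg_hom_def S'_def Fm k Tm)
  have "k ` carrier S' = carrier B"
  proof
    show "k ` carrier S' \<subseteq> carrier B" using kB by (auto simp: S'_def k)
    show "carrier B \<subseteq> k ` carrier S'"
    proof
      fix b assume b: "b \<in> carrier B"
      then have "k (F (Var b)) = b" using k[OF Tv] by simp
      then show "b \<in> k ` carrier S'" using Tv[OF b] by (force simp: S'_def)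
    qed
  qed
  with sub hom algB show ?thesis
    unfolding in_variety_def in_HSP_def P_def by blast
qed

section \<open>Equational complexity\<close>

text \<open>Every finite algebra is isomorphic to one whose carrier is a set of natural numbers,
  and a single equation contains only finitely many variables, so \<open>B\<close> ranges over
  algebras on \<^typ>\<open>nat\<close>, and equations are formed from variables in \<^typ>\<open>nat\<close>.\<close>

definition eq_complexity :: "'a sr_alg \<Rightarrow> nat \<Rightarrow> nat" where
  "eq_complexity A n = (LEAST l. \<forall>B :: nat sr_alg.
     is_alg B \<and> finite (carrier B) \<and> card (carrier B) < n \<and> \<not> in_variety A B \<longrightarrow>
     (\<exists>u v :: nat sr_term. satisfies A u v \<and> \<not> satisfies B u v \<and> equation_length u v \<le> l))"

end

(* Let B have fewer than n elements and satisfy all equations of flat(G) up to a length of order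
   (log n)^3. For p in B, the elements b whose idempotent power b^(2|G|) satisfies
   p <= p b^(2|G|), taken modulo "b meet b' is again such an element", form a group H of order
   less than n. If for every p the homomorphisms H -> G separate the points of H, then B satisfies
   all equations of flat(G), hence lies in its variety. So it suffices to derive h = 1 from
   "every homomorphism H -> G kills h", and a quasi-identity of G of length O((log n)^3) does this:

   - An iterated commutator of conjugates of x_i x_j^-1, i < j <= |G|, vanishes on G by the pigeonhole
     principle, but not on a nonabelian simple group of order exceeding |G|. This is a law of bounded
     length, so it holds in H; hence every nontrivial subgroup of H has a proper subgroup of bounded
     index, namely a maximal normal one.
   - A chain of subgroups of bounded index has length at most log n. Its transversals X give every
     element x of H a normal form nf x of length at most log n, and the |X|^2 relations
     s t = nf (s t) suffice for a map X -> G to extend to a homomorphism on H. *)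
theory Submission
  imports Defs "HOL-Algebra.Multiplicative_Group" "HOL-Algebra.SimpleGroups"
begin

section \<open>Subgroups of bounded index\<close>

text \<open>Two obstacles shape the proof. The first: whether homomorphisms into G separate H is a
  matter of quasi-identities, whereas only equations of flat(G) are available. A fresh variable x
  bridges the gap: x t^(2|G|) equals x or 0 according to whether t is nonzero, so the implication
  from nonzero premises to a nonzero conclusion becomes one equation, and evaluating x at p turns
  being nonzero into membership in \<open>D\<close>. The second is length: with the multiplication
  table of H as premises, the quasi-identity would have on the order of n^2 symbols. The composition
  factors of H are bounded, the abelian ones by the exponent 2|G| and the others by the commutator
  law; this leaves O(log n) letters, hence O((log n)^2) relations of length O(log n) each, which is
  the origin of the cube. Powers 2|G| instead of |G| make inverses positive powers even if G is
  trivial; the signature has neither inverses nor a constant.\<close>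

definition commutator :: "('a, 'm) monoid_scheme \<Rightarrow> 'a \<Rightarrow> 'a \<Rightarrow> 'a" where
  "commutator G a b = a \<otimes>\<^bsub>G\<^esub> b \<otimes>\<^bsub>G\<^esub> inv\<^bsub>G\<^esub> a \<otimes>\<^bsub>G\<^esub> inv\<^bsub>G\<^esub> b"

text \<open>Each pair carries its own conjugator \<open>y q\<close>, so the conjugators can be
  chosen one after another without disturbing earlier choices.\<close>

primrec iterated_commutator ::
  "('a, 'm) monoid_scheme \<Rightarrow> 'a \<Rightarrow> (nat \<Rightarrow> 'a) \<Rightarrow> (nat \<times> nat \<Rightarrow> 'a) \<Rightarrow> (nat \<times> nat) list \<Rightarrow> 'a" where
  "iterated_commutator G a x y [] = a"
| "iterated_commutator G a x y (q # qs) =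
     commutator G (iterated_commutator G a x y qs)
       (y q \<otimes>\<^bsub>G\<^esub> (x (fst q) \<otimes>\<^bsub>G\<^esub> inv\<^bsub>G\<^esub> x (snd q)) \<otimes>\<^bsub>G\<^esub> inv\<^bsub>G\<^esub> y q)"

text \<open>Indices run up to m inclusive: m + 1 elements are compared, one more than a group of
  order m has.\<close>

definition index_pairs :: "nat \<Rightarrow> (nat \<times> nat) list" where
  "index_pairs m = filter (\<lambda>(i, j). i < j) (List.product [0..<Suc m] [0..<Suc m])"

lemma set_index_pairs: "set (index_pairs m) = {(i, j). i < j \<and> j \<le> m}"
  by (auto simp: index_pairs_def simp del: upt_Suc)

definition bounding_law :: "('a, 'm) monoid_scheme \<Rightarrow> nat \<Rightarrow> bool" where
  "bounding_law G m \<longleftrightarrow> (\<forall>a x y. a \<in> carrier G \<longrightarrow> range x \<subseteq> carrier G \<longrightarrow> range y \<subseteq> carrier G \<longrightarrow>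
     iterated_commutator G a x y (index_pairs m) = \<one>\<^bsub>G\<^esub>)"

context group
begin

lemma commutator_closed: "a \<in> carrier G \<Longrightarrow> b \<in> carrier G \<Longrightarrow> commutator G a b \<in> carrier G"
  by (simp add: commutator_def)

lemma iterated_commutator_closed:
  assumes "a \<in> carrier G" "range x \<subseteq> carrier G" "range y \<subseteq> carrier G"
  shows "iterated_commutator G a x y qs \<in> carrier G"
proof -
  have "x i \<in> carrier G" "y q \<in> carrier G" for i q using assms by auto
  then show ?thesis using assms by (induction qs) (auto intro!: commutator_closed)
qed

text \<open>The entry of the pair (i, j) is trivial, a commutator with 1 is 1, and this survives all
  later steps.\<close>

lemma iterated_commutator_collapse:
  assumes "a \<in> carrier G" "range x \<subseteq> carrier G" "range y \<subseteq> carrier G"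
    and "(i, j) \<in> set qs" "x i = x j"
  shows "iterated_commutator G a x y qs = \<one>"
  using assms(4)
proof (induction qs)
  case (Cons q qs)
  have x: "x i \<in> carrier G" "y q \<in> carrier G" for i q using assms by auto
  have c: "iterated_commutator G a x y qs \<in> carrier G"
    using assms(1-3) by (rule iterated_commutator_closed)
  show ?case
  proof (cases "q = (i, j)")
    case True
    then show ?thesis using x c assms(5) by (simp add: commutator_def)
  next
    case False
    then have "iterated_commutator G a x y qs = \<one>" using Cons by auto
    then show ?thesis using x by (simp add: commutator_def)
  qed
qed simp

lemma bounding_law_order:
  assumes "finite (carrier G)"
  shows "bounding_law G (order G)"
  unfolding bounding_law_def
proof (intro allI impI)
  fix a and x :: "nat \<Rightarrow> 'a" and y :: "nat \<times> nat \<Rightarrow> 'a"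
  assume *: "a \<in> carrier G" "range x \<subseteq> carrier G" "range y \<subseteq> carrier G"
  have "card (x ` {..order G}) \<le> order G"
    using * assms by (auto simp: order_def intro!: card_mono)
  then have "\<not> inj_on x {..order G}" by (auto dest: card_image)
  then obtain i j where ij: "i \<le> order G" "j \<le> order G" "i \<noteq> j" "x i = x j"
    by (auto simp: inj_on_def)
  consider "i < j" | "j < i" using ij(3) by linarith
  then show "iterated_commutator G a x y (index_pairs (order G)) = \<one>"
  proof cases
    case 1
    then show ?thesis
      using ij by (intro iterated_commutator_collapse[OF *, of i j]) (auto simp: set_index_pairs)
  next
    case 2
    then show ?thesis
      using ij by (intro iterated_commutator_collapse[OF *, of j i]) (auto simp: set_index_pairs)
  qed
qed

lemma commutator_eq_one_iff:
  assumes "a \<in> carrier G" "b \<in> carrier G"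
  shows "commutator G a b = \<one> \<longleftrightarrow> a \<otimes> b = b \<otimes> a"
proof
  assume "commutator G a b = \<one>"
  then have "commutator G a b \<otimes> b \<otimes> a = b \<otimes> a" using assms by simp
  then show "a \<otimes> b = b \<otimes> a" using assms by (simp add: commutator_def m_assoc)
next
  assume "a \<otimes> b = b \<otimes> a"
  then have "commutator G a b = b \<otimes> a \<otimes> inv a \<otimes> inv b" by (simp add: commutator_def)
  then show "commutator G a b = \<one>" using assms by (simp add: m_assoc)
qed

lemma centralizer_subgroup:
  assumes a: "a \<in> carrier G"
  shows "subgroup {g \<in> carrier G. a \<otimes> g = g \<otimes> a} G"
proof (rule subgroupI)
  fix g h assume "g \<in> {g \<in> carrier G. a \<otimes> g = g \<otimes> a}" "h \<in> {g \<in> carrier G. a \<otimes> g = g \<otimes> a}"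
  then show "g \<otimes> h \<in> {g \<in> carrier G. a \<otimes> g = g \<otimes> a}"
    using a by simp (metis m_assoc)
next
  fix g assume "g \<in> {g \<in> carrier G. a \<otimes> g = g \<otimes> a}"
  then show "inv g \<in> {g \<in> carrier G. a \<otimes> g = g \<otimes> a}"
    using a by simp (metis inv_solve_left inv_solve_right m_closed inv_closed m_assoc)
qed (use a in auto)

text \<open>The set is the normal core of C, the intersection of its conjugates.\<close>

lemma normal_core:
  assumes "subgroup C G"
  shows "{g \<in> carrier G. \<forall>y\<in>carrier G. y \<otimes> g \<otimes> inv y \<in> C} \<lhd> G"
    (is "?N \<lhd> G")
proof -
  interpret C: subgroup C G by fact
  have mult: "y \<otimes> (g \<otimes> h) \<otimes> inv y = (y \<otimes> g \<otimes> inv y) \<otimes> (y \<otimes> h \<otimes> inv y)"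
    if "y \<in> carrier G" "g \<in> carrier G" "h \<in> carrier G" for y g h
  proof -
    have "inv y \<otimes> (y \<otimes> (h \<otimes> inv y)) = h \<otimes> inv y" using that by (simp add: m_assoc[symmetric])
    then show ?thesis using that by (simp add: m_assoc)
  qed
  have inv: "y \<otimes> inv g \<otimes> inv y = inv (y \<otimes> g \<otimes> inv y)" if "y \<in> carrier G" "g \<in> carrier G" for y g
    using that by (simp add: inv_mult_group m_assoc)
  have conj: "y \<otimes> (z \<otimes> g \<otimes> inv z) \<otimes> inv y = (y \<otimes> z) \<otimes> g \<otimes> inv (y \<otimes> z)"
    if "y \<in> carrier G" "g \<in> carrier G" "z \<in> carrier G" for y g z
    using that by (simp add: inv_mult_group m_assoc)
  show ?thesis unfolding normal_inv_iff
  proof (intro conjI ballI subgroupI)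
    have "\<one> \<in> ?N" by simp
    then show "?N \<noteq> {}" by blast
    fix g h assume gh: "g \<in> ?N" "h \<in> ?N"
    show "g \<otimes> h \<in> ?N" using gh by (auto simp: mult)
  next
    fix g assume gh: "g \<in> ?N"
    show "inv g \<in> ?N" using gh by (auto simp: inv)
  next
    fix x h assume "x \<in> carrier G" "h \<in> ?N"
    then show "x \<otimes> h \<otimes> inv x \<in> ?N" by (auto simp: conj)
  qed auto
qed

end

text \<open>If every conjugate of b commutes with a, then b lies in the core of the centralizer of
  a. By simplicity this core is the whole group, so a is central. Then a lies in the core of the
  centralizer of every c, so every c is central too.\<close>

lemma (in simple_group) exists_noncommuting_conjugate:
  assumes "\<not> comm_group G" and a: "a \<in> carrier G" "a \<noteq> \<one>" and b: "b \<in> carrier G" "b \<noteq> \<one>"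
  shows "\<exists>y\<in>carrier G. commutator G a (y \<otimes> b \<otimes> inv y) \<noteq> \<one>"
proof (rule ccontr)
  define C where "C c = {g \<in> carrier G. c \<otimes> g = g \<otimes> c}" for c
  define N where "N c = {g \<in> carrier G. \<forall>y\<in>carrier G. y \<otimes> g \<otimes> inv y \<in> C c}" for c
  have whole: "N c = carrier G" if "c \<in> carrier G" "d \<in> N c" "d \<noteq> \<one>" for c d
    using no_real_normal_subgroup[OF normal_core[OF centralizer_subgroup[of c]]] that
    unfolding N_def C_def by blast
  have commute: "c \<otimes> g = g \<otimes> c" if "c \<in> carrier G" "g \<in> carrier G" "N c = carrier G" for c g
  proof -
    have "\<one> \<otimes> g \<otimes> inv \<one> \<in> C c"
      using that one_closed unfolding N_def by blast
    then show ?thesis using that by (simp add: C_def)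
  qed
  assume "\<not> ?thesis"
  then have "b \<in> N a" using a b by (auto simp: N_def C_def commutator_eq_one_iff)
  then have Na: "N a = carrier G" using whole a b by blast
  have comm: "a \<otimes> g = g \<otimes> a" if "g \<in> carrier G" for g
    using commute a that Na by blast
  have "a \<in> N c" if c: "c \<in> carrier G" for c
  proof -
    have "y \<otimes> a \<otimes> inv y = a" if "y \<in> carrier G" for y
      using comm[OF that] a that by (metis inv_closed m_assoc r_inv r_one)
    then show ?thesis using a c comm[OF c] by (simp add: N_def C_def)
  qed
  then have "N c = carrier G" if "c \<in> carrier G" for c using whole[of c a] a that by simp
  then have "c \<otimes> g = g \<otimes> c" if "c \<in> carrier G" "g \<in> carrier G" for c g
    using that commute[of c g] by simp
  then have "comm_group G" by (intro group_comm_groupI) auto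
  then show False using assms(1) by simp
qed

text \<open>With m + 1 distinct elements x i, a nontrivial value of the law is built pair by pair:
  each step picks a conjugate that does not commute with the value so far.\<close>

lemma (in simple_group) order_le_if_bounding_law:
  assumes nc: "\<not> comm_group G" and fin: "finite (carrier G)" and law: "bounding_law G m"
  shows "order G \<le> m"
proof (rule ccontr)
  assume "\<not> order G \<le> m"
  then have "card {..m} \<le> card (carrier G)" by (simp add: order_def)
  then obtain x0 where x0: "x0 ` {..m} \<subseteq> carrier G" "inj_on x0 {..m}"
    using card_le_inj[of "{..m}" "carrier G"] fin by auto
  define x where "x i = (if i \<le> m then x0 i else \<one>)" for i
  have x: "x i \<in> carrier G" for i using x0 by (auto simp: x_def)
  have neq: "x i \<otimes> inv x j \<noteq> \<one>" if "(i, j) \<in> set (index_pairs m)" for i j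
  proof
    assume "x i \<otimes> inv x j = \<one>"
    then have "x i = x j" using x by (metis inv_closed inv_equality inv_inv)
    then show False using that x0(2) by (auto simp: set_index_pairs x_def inj_on_def)
  qed
  obtain a where a: "a \<in> carrier G" "a \<noteq> \<one>" using simple_not_triv one_closed by blast
  have "\<exists>y. range y \<subseteq> carrier G \<and> iterated_commutator G a x y qs \<noteq> \<one>"
    if "set qs \<subseteq> set (index_pairs m)" "distinct qs" for qs
    using that
  proof (induction qs)
    case Nil
    then show ?case using a by (auto intro!: exI[of _ "\<lambda>_. \<one>"])
  next
    case (Cons q qs)
    then obtain y where y: "range y \<subseteq> carrier G" "iterated_commutator G a x y qs \<noteq> \<one>" by auto
    have c: "iterated_commutator G a x y qs \<in> carrier G"
      using a x y by (intro iterated_commutator_closed) auto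
    have "x (fst q) \<otimes> inv x (snd q) \<noteq> \<one>" using neq[of "fst q" "snd q"] Cons by auto
    then obtain z where z: "z \<in> carrier G"
      "commutator G (iterated_commutator G a x y qs) (z \<otimes> (x (fst q) \<otimes> inv x (snd q)) \<otimes> inv z) \<noteq> \<one>"
      using exists_noncommuting_conjugate[OF nc c y(2), of "x (fst q) \<otimes> inv x (snd q)"] x by auto
    \<comment> \<open>The pairs are distinct, so redefining \<open>y\<close> at q leaves the value
      on qs alone.\<close>
    have upd: "iterated_commutator G a x (y(q := z)) rs = iterated_commutator G a x y rs" if "q \<notin> set rs" for rs
      using that by (induction rs) auto
    have "iterated_commutator G a x (y(q := z)) (q # qs) \<noteq> \<one>"
      using upd[of qs] Cons.prems z(2) by (simp del: fun_upd_apply) simp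
    moreover have "range (y(q := z)) \<subseteq> carrier G" using y z by auto
    ultimately show ?case by blast
  qed
  moreover have "distinct (index_pairs m)"
    by (simp add: index_pairs_def distinct_product del: upt_Suc)
  ultimately obtain y where "range y \<subseteq> carrier G" "iterated_commutator G a x y (index_pairs m) \<noteq> \<one>"
    by blast
  then show False using law a x unfolding bounding_law_def by blast
qed

text \<open>A commutative simple group is generated by any nontrivial element, and the order of that
  element divides n.\<close>

lemma (in simple_group) order_le_if_comm:
  assumes "comm_group G" and fin: "finite (carrier G)" and n: "n > 0"
    and pow: "\<And>x. x \<in> carrier G \<Longrightarrow> x [^] (n::nat) = \<one>"
  shows "order G \<le> n"
proof -
  interpret comm_group G by fact
  obtain a where a: "a \<in> carrier G" "a \<noteq> \<one>" using simple_not_triv one_closed by blast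
  have "subgroup (generate G {a}) G" using a by (intro generate_is_subgroup) auto
  then have "generate G {a} \<lhd> G" by (rule subgroup_imp_normal)
  moreover have "a \<in> generate G {a}" by (simp add: generate.incl)
  ultimately have "generate G {a} = carrier G" using no_real_normal_subgroup a by blast
  then have "ord a = order G" using generate_pow_card[OF a(1)] by (simp add: order_def)
  moreover have "ord a dvd n" using pow a pow_eq_id by simp
  ultimately show ?thesis using n by (simp add: dvd_imp_le)
qed

lemma (in group_hom) normal_preimage:
  assumes "M \<lhd> H"
  shows "{g \<in> carrier G. h g \<in> M} \<lhd> G"
proof -
  interpret M: normal M H by fact
  show ?thesis unfolding G.normal_inv_iff
  proof (intro conjI ballI G.subgroupI)
    have "\<one> \<in> {g \<in> carrier G. h g \<in> M}" by auto
    then show "{g \<in> carrier G. h g \<in> M} \<noteq> {}" by blast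
  qed (auto simp: M.inv_op_closed2)
qed

lemma (in group_hom) iterated_commutator_hom:
  fixes x :: "nat \<Rightarrow> 'a" and y :: "nat \<times> nat \<Rightarrow> 'a"
  assumes "a \<in> carrier G" "range x \<subseteq> carrier G" "range y \<subseteq> carrier G"
  shows "h (iterated_commutator G a x y qs) = iterated_commutator H (h a) (h \<circ> x) (h \<circ> y) qs"
proof -
  have "x i \<in> carrier G" "y q \<in> carrier G" for i q using assms by auto
  then show ?thesis using G.iterated_commutator_closed[OF assms]
    by (induction qs) (simp_all add: commutator_def)
qed

lemma (in group_hom) bounding_law_image:
  assumes "bounding_law G m" and surj: "h ` carrier G = carrier H"
  shows "bounding_law H m"
  unfolding bounding_law_def
proof (intro allI impI)
  fix a and x :: "nat \<Rightarrow> 'c" and y :: "nat \<times> nat \<Rightarrow> 'c"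
  assume *: "a \<in> carrier H" "range x \<subseteq> carrier H" "range y \<subseteq> carrier H"
  define k where "k = inv_into (carrier G) h"
  have k: "k b \<in> carrier G" "h (k b) = b" if "b \<in> carrier H" for b
    using that surj by (auto simp: k_def inv_into_into f_inv_into_f)
  have "iterated_commutator H (h (k a)) (h \<circ> (k \<circ> x)) (h \<circ> (k \<circ> y)) (index_pairs m)
     = h (iterated_commutator G (k a) (k \<circ> x) (k \<circ> y) (index_pairs m))"
    using * k by (intro iterated_commutator_hom[symmetric]) auto
  also have "iterated_commutator G (k a) (k \<circ> x) (k \<circ> y) (index_pairs m) = \<one>\<^bsub>G\<^esub>"
    using assms(1) * k unfolding bounding_law_def by (auto simp: image_subset_iff)
  also have "h (k a) = a" using * k by simp
  also have "h \<circ> (k \<circ> x) = x" using * k by (auto simp: fun_eq_iff)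
  also have "h \<circ> (k \<circ> y) = y" using * k by (auto simp: fun_eq_iff)
  finally show "iterated_commutator H a x y (index_pairs m) = \<one>\<^bsub>H\<^esub>" by simp
qed

text \<open>N is a proper normal subgroup of largest cardinality. A normal subgroup of the quotient
  has a normal preimage containing N, which is therefore G or N.\<close>

lemma (in group) exists_simple_quotient:
  assumes fin: "finite (carrier G)" and nontriv: "carrier G \<noteq> {\<one>}"
  shows "\<exists>N. N \<lhd> G \<and> N \<noteq> carrier G \<and> simple_group (G Mod N)"
proof -
  define P where "P N \<longleftrightarrow> N \<lhd> G \<and> N \<noteq> carrier G" for N
  have "P {\<one>}" using nontriv one_is_normal by (auto simp: P_def)
  moreover have bd: "card N < Suc (order G)" if "P N" for N
    using that fin normal_imp_subgroup subgroup.subset unfolding P_def order_def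
    by (metis card_mono less_Suc_eq_le)
  ultimately obtain N where PN: "P N" and max: "\<And>M. P M \<Longrightarrow> card M \<le> card N"
    using ex_has_greatest_nat[of P "{\<one>}" card "Suc (order G)"] by blast
  then interpret N: normal N G by (simp add: P_def)
  interpret Q: group "G Mod N" by (rule N.factorgroup_is_group)
  interpret q: group_hom G "G Mod N" "\<lambda>a. N #> a"
    by unfold_locales (rule N.r_coset_hom_Mod)
  have coset: "N #> g = N \<longleftrightarrow> g \<in> N" if "g \<in> carrier G" for g
    using that N.subgroup_axioms by (metis coset_join1 coset_join2 N.subset)
  have "simple_group (G Mod N)"
  proof (unfold_locales)
    obtain g where g: "g \<in> carrier G" "g \<notin> N" using PN N.subset by (auto simp: P_def)
    have "{N, N #> g} \<subseteq> carrier (G Mod N)"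
      using g Q.one_closed by (auto simp: carrier_FactGroup)
    moreover have "card {N, N #> g} = 2"
      using coset[OF g(1)] g(2) by (metis card_2_iff)
    moreover have "finite (carrier (G Mod N))" using fin by (simp add: carrier_FactGroup)
    ultimately show "1 < order (G Mod N)"
      unfolding order_def by (metis card_mono one_less_numeral_iff order_less_le_trans semiring_norm(76))
  next
    fix M assume M: "M \<lhd> G Mod N"
    interpret M: normal M "G Mod N" by fact
    define M' where "M' = {g \<in> carrier G. N #> g \<in> M}"
    have M': "M' \<lhd> G" unfolding M'_def by (rule q.normal_preimage[OF M])
    have NM: "N \<subseteq> M'"
    proof
      fix g assume g: "g \<in> N"
      then have "N #> g = N" using coset N.subset by blast
      then show "g \<in> M'" using g N.subset M.one_closed by (auto simp: M'_def)
    qed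
    have im: "M = (\<lambda>g. N #> g) ` M'"
      using M.subset unfolding M'_def carrier_FactGroup by auto
    show "M = carrier (G Mod N) \<or> M = {\<one>\<^bsub>G Mod N\<^esub>}"
    proof (cases "M' = carrier G")
      case True
      then show ?thesis by (simp add: im carrier_FactGroup)
    next
      case False
      then have "card M' \<le> card N" using M' max by (auto simp: P_def)
      moreover have "finite M'" using fin by (simp add: M'_def)
      ultimately have "N = M'" using NM by (metis card_seteq)
      then have "N #> g = N" if "g \<in> M'" for g using coset N.subset that by blast
      then have "M = {N}" using N.one_closed \<open>N = M'\<close> unfolding im by blast
      then show ?thesis by simp
    qed
  qed
  then show ?thesis using PN by (auto simp: P_def)
qed

text \<open>The simple quotient has order at most m if it is nonabelian and at most n if it is
  commutative; Lagrange's theorem turns this into an index.\<close>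

lemma (in group) exists_subgroup_of_bounded_index:
  assumes fin: "finite (carrier G)" and nontriv: "carrier G \<noteq> {\<one>}"
    and law: "bounding_law G m" and n: "n > 0"
    and pow: "\<And>x. x \<in> carrier G \<Longrightarrow> x [^] (n::nat) = \<one>"
  shows "\<exists>N. subgroup N G \<and> N \<noteq> carrier G \<and> order G \<le> max m n * card N"
proof -
  obtain N where N: "N \<lhd> G" "N \<noteq> carrier G" "simple_group (G Mod N)"
    using exists_simple_quotient[OF fin nontriv] by blast
  interpret N: normal N G by fact
  interpret Q: simple_group "G Mod N" by fact
  interpret q: group_hom G "G Mod N" "\<lambda>a. N #> a"
    by unfold_locales (rule N.r_coset_hom_Mod)
  have surj: "(\<lambda>a. N #> a) ` carrier G = carrier (G Mod N)" by (simp add: carrier_FactGroup)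
  have finQ: "finite (carrier (G Mod N))" using fin by (simp add: carrier_FactGroup)
  have "order (G Mod N) \<le> max m n"
  proof (cases "comm_group (G Mod N)")
    case True
    have "X [^]\<^bsub>G Mod N\<^esub> n = \<one>\<^bsub>G Mod N\<^esub>" if X: "X \<in> carrier (G Mod N)" for X
    proof -
      obtain x where x: "x \<in> carrier G" "X = N #> x" using X by (auto simp: carrier_FactGroup)
      then show ?thesis using pow[of x] by (simp add: N.FactGroup_pow)
    qed
    then have "order (G Mod N) \<le> n" by (rule Q.order_le_if_comm[OF True finQ n])
    then show ?thesis by simp
  next
    case False
    have "order (G Mod N) \<le> m"
      using q.bounding_law_image[OF law surj] by (rule Q.order_le_if_bounding_law[OF False finQ])
    then show ?thesis by simp
  qed
  moreover have "order G = order (G Mod N) * card N"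
    using lagrange[OF N.subgroup_axioms] by (simp add: order_def FactGroup_def)
  ultimately show ?thesis using N(2) N.subgroup_axioms by (metis mult_le_mono1)
qed

section \<open>Normal forms along a chain of subgroups\<close>

definition word_value :: "('b, 'm) monoid_scheme \<Rightarrow> ('x \<Rightarrow> 'b) \<Rightarrow> 'x list \<Rightarrow> 'b" where
  "word_value L f xs = foldr (\<lambda>s a. f s \<otimes>\<^bsub>L\<^esub> a) xs \<one>\<^bsub>L\<^esub>"

lemma word_value_simps [simp]:
  "word_value L f [] = \<one>\<^bsub>L\<^esub>"
  "word_value L f (s # xs) = f s \<otimes>\<^bsub>L\<^esub> word_value L f xs"
  by (simp_all add: word_value_def)

lemma (in group) word_value_closed:
  "f ` set xs \<subseteq> carrier G \<Longrightarrow> word_value G f xs \<in> carrier G"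
  by (induction xs) auto

text \<open>The last conjunct says that the relations \<open>s t = nf (s t)\<close>, \<open>s, t \<in> X\<close>, present \<open>K\<close> as far as
  homomorphisms into \<open>L\<close> are concerned.\<close>
definition normal_forms ::
  "('a, 'm) monoid_scheme \<Rightarrow> ('b, 'n) monoid_scheme \<Rightarrow> 'a set \<Rightarrow> 'a set \<Rightarrow> ('a \<Rightarrow> 'a list) \<Rightarrow> nat \<Rightarrow> bool" where
  "normal_forms G L K X nf r \<longleftrightarrow> X \<subseteq> K \<and>
     (\<forall>k\<in>K. length (nf k) \<le> r \<and> set (nf k) \<subseteq> X \<and> word_value G (\<lambda>x. x) (nf k) = k) \<and>
     nf \<one>\<^bsub>G\<^esub> = [] \<and> (\<forall>s\<in>X. nf s = [s]) \<and>
     (\<forall>f. f ` X \<subseteq> carrier L \<longrightarrow>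
        (\<forall>s\<in>X. \<forall>t\<in>X. f s \<otimes>\<^bsub>L\<^esub> f t = word_value L f (nf (s \<otimes>\<^bsub>G\<^esub> t))) \<longrightarrow>
        (\<forall>x\<in>K. \<forall>y\<in>K. word_value L f (nf (x \<otimes>\<^bsub>G\<^esub> y)) = word_value L f (nf x) \<otimes>\<^bsub>L\<^esub> word_value L f (nf y)))"

text \<open>One transversal is added per step. On S the extension of f is known; across cosets only
  the relations for a letter times a representative are needed, and the rest is associativity. Since
  S is proper, the cardinality at least doubles, which keeps r logarithmic.\<close>

lemma (in group) normal_forms_extend:
  assumes K: "subgroup K G" and fin: "finite K" and S: "subgroup S G" "S \<subset> K"
    and idx: "card K \<le> c * card S" and L: "group L"
    and nfS: "normal_forms G L S Y nf r" and Y: "finite Y" "card Y \<le> c * r" "2 ^ r \<le> card S"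
  shows "\<exists>X nf'. normal_forms G L K X nf' (Suc r) \<and> finite X \<and> card X \<le> c * Suc r \<and> 2 ^ Suc r \<le> card K"
proof -
  interpret K: subgroup K G by fact
  interpret S: subgroup S G by fact
  interpret L: group L by fact
  have SK: "x \<in> K" if "x \<in> S" for x using that S by blast
  have KG: "x \<in> carrier G" if "x \<in> K" for x using that by simp
  note [simp] = SK KG
  \<comment> \<open>Representatives of the left cosets of \<open>S\<close>. The trivial coset contributes no letter, so that
    the normal forms of \<open>S\<close> and the relations between them remain unchanged.\<close>
  define \<rho> where "\<rho> k = (if k \<in> S then \<one> else (SOME x. x \<in> K \<and> inv x \<otimes> k \<in> S))" for k
  have \<rho>: "\<rho> k \<in> K" "inv (\<rho> k) \<otimes> k \<in> S" if "k \<in> K" for k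
  proof -
    have "k \<in> K \<and> inv k \<otimes> k \<in> S" using that by simp
    then have "(SOME x. x \<in> K \<and> inv x \<otimes> k \<in> S) \<in> K \<and> inv (SOME x. x \<in> K \<and> inv x \<otimes> k \<in> S) \<otimes> k \<in> S"
      by (rule someI)
    then show "\<rho> k \<in> K" "inv (\<rho> k) \<otimes> k \<in> S" by (auto simp: \<rho>_def)
  qed
  have shift: "x \<otimes> u \<in> S \<longleftrightarrow> x \<in> S" if "x \<in> carrier G" "u \<in> S" for x u
    using that by (metis S.m_closed S.m_inv_closed S.mem_carrier inv_solve_right)
  have \<rho>_shift: "\<rho> (k \<otimes> u) = \<rho> k" if "k \<in> K" "u \<in> S" for k u
  proof -
    have "inv x \<otimes> (k \<otimes> u) \<in> S \<longleftrightarrow> inv x \<otimes> k \<in> S" if "x \<in> K" for x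
      using shift[of "inv x \<otimes> k" u] \<open>k \<in> K\<close> \<open>u \<in> S\<close> that by (simp add: m_assoc)
    then have "(\<lambda>x. x \<in> K \<and> inv x \<otimes> (k \<otimes> u) \<in> S) = (\<lambda>x. x \<in> K \<and> inv x \<otimes> k \<in> S)" by auto
    then show ?thesis using shift[of k u] that by (simp add: \<rho>_def)
  qed
  have decomp: "k = \<rho> k \<otimes> (inv (\<rho> k) \<otimes> k)" if "k \<in> K" for k
    using that \<rho>(1)[OF that] by (simp add: m_assoc[symmetric])
  have \<rho>S: "\<rho> k \<in> S \<longleftrightarrow> k \<in> S" if "k \<in> K" for k
    using shift[of "\<rho> k" "inv (\<rho> k) \<otimes> k"] decomp[OF that] \<rho>[OF that] by simp
  have \<rho>\<rho>: "\<rho> (\<rho> k) = \<rho> k" if "k \<in> K" for k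
    using \<rho>_shift[of "\<rho> k" "inv (\<rho> k) \<otimes> k"] decomp[OF that] \<rho>[OF that] by simp
  define T where "T = \<rho> ` (K - S)"
  have T: "t \<in> K" "t \<notin> S" "\<rho> t = t" if "t \<in> T" for t
    using that \<rho> \<rho>S \<rho>\<rho> by (auto simp: T_def)
  have \<rho>T: "\<rho> k \<in> T" if "k \<in> K" "k \<notin> S" for k using that by (auto simp: T_def)
  have finT: "finite T" and finS: "finite S"
    using fin S by (auto simp: T_def intro: finite_subset)
  \<comment> \<open>The representatives lie in distinct left cosets, so T times S embeds in K and
    the index bounds T.\<close>
  have "inj_on (\<lambda>(t, u). t \<otimes> u) (T \<times> S)"
  proof (rule inj_onI, clarify)
    fix t u t' u' assume *: "t \<in> T" "u \<in> S" "t' \<in> T" "u' \<in> S" "t \<otimes> u = t' \<otimes> u'"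
    then have "t = t'" using \<rho>_shift[of t u] \<rho>_shift[of t' u'] T by metis
    then show "t = t' \<and> u = u'" using * T by simp
  qed
  moreover have "(\<lambda>(t, u). t \<otimes> u) ` (T \<times> S) \<subseteq> K" using T by auto
  ultimately have "card (T \<times> S) \<le> card K" using fin by (metis card_image card_mono)
  then have "card T * card S \<le> c * card S" using idx by (metis card_cartesian_product le_trans)
  moreover have Spos: "card S > 0" using finS S.one_closed card_gt_0_iff by blast
  ultimately have cT: "card T \<le> c" by simp
  \<comment> \<open>A second coset of S fits into K - S, hence 2 |S| is at most |K|.\<close>
  obtain k0 where k0: "k0 \<in> K" "k0 \<notin> S" using S by blast
  have "inj_on (\<lambda>u. k0 \<otimes> u) S" using k0 by (intro inj_onI) simp
  moreover have "(\<lambda>u. k0 \<otimes> u) ` S \<subseteq> K - S" using k0 shift by auto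
  ultimately have "card S \<le> card (K - S)" using fin by (metis card_image card_mono finite_Diff)
  also have "card (K - S) = card K - card S" using S finS by (intro card_Diff_subset) auto
  finally have "2 * card S \<le> card K" using Spos by linarith
  then have pow: "2 ^ Suc r \<le> card K" using Y(3) by simp

  define nf' where "nf' k = (if k \<in> S then nf k else \<rho> k # nf (inv (\<rho> k) \<otimes> k))" for k
  have YS: "Y \<subseteq> S" and len: "\<And>k. k \<in> S \<Longrightarrow> length (nf k) \<le> r"
    and letters: "\<And>k. k \<in> S \<Longrightarrow> set (nf k) \<subseteq> Y" and val: "\<And>k. k \<in> S \<Longrightarrow> word_value G (\<lambda>x. x) (nf k) = k"
    and nf1: "nf \<one> = []" and nfY: "\<And>s. s \<in> Y \<Longrightarrow> nf s = [s]"
    and homS: "\<And>f x y. f ` Y \<subseteq> carrier L \<Longrightarrow>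
        (\<forall>s\<in>Y. \<forall>t\<in>Y. f s \<otimes>\<^bsub>L\<^esub> f t = word_value L f (nf (s \<otimes> t))) \<Longrightarrow> x \<in> S \<Longrightarrow> y \<in> S \<Longrightarrow>
        word_value L f (nf (x \<otimes> y)) = word_value L f (nf x) \<otimes>\<^bsub>L\<^esub> word_value L f (nf y)"
    using nfS unfolding normal_forms_def by blast+
  have "card (Y \<union> T) \<le> card Y + card T" by (rule card_Un_le)
  then have cX: "card (Y \<union> T) \<le> c * Suc r" using Y(2) cT by simp
  \<comment> \<open>Here \<open>nf \<one> = []\<close> matters: it makes a representative a word of
    a single letter.\<close>
  have nfT: "nf' t = [t]" if "t \<in> T" for t using T[OF that] nf1 by (simp add: nf'_def)
  have nfX: "nf' s = [s]" if "s \<in> Y \<union> T" for s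
  proof (cases "s \<in> T")
    case False
    then have "s \<in> Y" "s \<in> S" using that YS by auto
    then show ?thesis using nfY by (simp add: nf'_def)
  qed (rule nfT)
  have letters': "set (nf' k) \<subseteq> Y \<union> T" if "k \<in> K" for k
    using that letters \<rho>[OF that] \<rho>T by (auto simp: nf'_def)
  have val': "word_value G (\<lambda>x. x) (nf' k) = k" if "k \<in> K" for k
    using val val[OF \<rho>(2)[OF that]] decomp[OF that] by (simp add: nf'_def)
  \<comment> \<open>Multiplicativity spreads from S times S to K times S on the right, then to a
    letter times K on the left, and finally to words in the letters.\<close>
  have hom: "word_value L f (nf' (x \<otimes> y)) = word_value L f (nf' x) \<otimes>\<^bsub>L\<^esub> word_value L f (nf' y)"
    if f: "f ` (Y \<union> T) \<subseteq> carrier L"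
      and rel: "\<forall>s\<in>Y \<union> T. \<forall>t\<in>Y \<union> T. f s \<otimes>\<^bsub>L\<^esub> f t = word_value L f (nf' (s \<otimes> t))"
      and xy: "x \<in> K" "y \<in> K" for f x y
  proof -
    define \<phi> where "\<phi> k = word_value L f (nf' k)" for k
    have \<phi>c: "\<phi> k \<in> carrier L" if "k \<in> K" for k
      unfolding \<phi>_def using letters'[OF that] f by (intro L.word_value_closed) blast
    have fc: "f s \<in> carrier L" if "s \<in> Y \<union> T" for s using f that by blast
    have \<phi>S: "\<phi> k = word_value L f (nf k)" if "k \<in> S" for k using that by (simp add: \<phi>_def nf'_def)
    have hS: "\<phi> (u \<otimes> v) = \<phi> u \<otimes>\<^bsub>L\<^esub> \<phi> v" if "u \<in> S" "v \<in> S" for u v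
    proof -
      have "\<forall>s\<in>Y. \<forall>t\<in>Y. f s \<otimes>\<^bsub>L\<^esub> f t = word_value L f (nf (s \<otimes> t))"
        using rel YS by (simp add: nf'_def subset_iff)
      then show ?thesis using homS[of f u v] f that by (simp add: \<phi>S image_Un)
    qed
    have \<phi>X: "\<phi> s = f s" if "s \<in> Y \<union> T" for s using nfX[OF that] fc[OF that] by (simp add: \<phi>_def)
    have \<phi>T: "\<phi> (t \<otimes> u) = f t \<otimes>\<^bsub>L\<^esub> \<phi> u" if "t \<in> T" "u \<in> S" for t u
      using T[OF that(1)] that(2) \<rho>_shift[of t u] shift[of t u]
      by (simp add: \<phi>_def nf'_def m_assoc[symmetric])
    have hKS: "\<phi> (k \<otimes> u) = \<phi> k \<otimes>\<^bsub>L\<^esub> \<phi> u" if "k \<in> K" "u \<in> S" for k u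
    proof (cases "k \<in> S")
      case True
      then show ?thesis using hS that by simp
    next
      case False
      define v where "v = inv (\<rho> k) \<otimes> k"
      have v: "v \<in> S" "k = \<rho> k \<otimes> v" "\<rho> k \<in> T"
        using \<rho>[OF that(1)] decomp[OF that(1)] \<rho>T[OF that(1) False] by (auto simp: v_def)
      have "\<phi> (k \<otimes> u) = \<phi> (\<rho> k \<otimes> (v \<otimes> u))"
        using v(1) that \<rho>(1)[OF that(1)] by (subst v(2)) (simp add: m_assoc)
      also have "\<dots> = f (\<rho> k) \<otimes>\<^bsub>L\<^esub> (\<phi> v \<otimes>\<^bsub>L\<^esub> \<phi> u)" using v that \<phi>T hS by simp
      also have "\<dots> = (f (\<rho> k) \<otimes>\<^bsub>L\<^esub> \<phi> v) \<otimes>\<^bsub>L\<^esub> \<phi> u" using v that fc \<phi>c by (simp add: L.m_assoc)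
      also have "f (\<rho> k) \<otimes>\<^bsub>L\<^esub> \<phi> v = \<phi> k" using \<phi>T[OF v(3,1)] v(2) by simp
      finally show ?thesis .
    qed
    \<comment> \<open>With y = \<rho> y v, the relation for the letters s and \<rho> y settles s
      \<rho> y, and \<open>hKS\<close> absorbs v from the right.\<close>
    have hX: "\<phi> (s \<otimes> y) = f s \<otimes>\<^bsub>L\<^esub> \<phi> y" if s: "s \<in> Y \<union> T" and y: "y \<in> K" for s y
    proof -
      have sK: "s \<in> K" using s YS T by auto
      show ?thesis
      proof (cases "y \<in> S")
        case True
        then show ?thesis using hKS[OF sK] \<phi>X[OF s] by simp
      next
        case False
        define v where "v = inv (\<rho> y) \<otimes> y"
        have v: "v \<in> S" "y = \<rho> y \<otimes> v" "\<rho> y \<in> T"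
          using \<rho>[OF y] decomp[OF y] \<rho>T[OF y False] by (auto simp: v_def)
        have "\<phi> (s \<otimes> y) = \<phi> ((s \<otimes> \<rho> y) \<otimes> v)"
          using v(1) sK \<rho>(1)[OF y] by (subst v(2)) (simp add: m_assoc)
        also have "\<dots> = \<phi> (s \<otimes> \<rho> y) \<otimes>\<^bsub>L\<^esub> \<phi> v" using v sK \<rho>(1)[OF y] by (intro hKS) auto
        also have "\<phi> (s \<otimes> \<rho> y) = f s \<otimes>\<^bsub>L\<^esub> f (\<rho> y)" using rel s v(3) by (simp add: \<phi>_def)
        also have "f s \<otimes>\<^bsub>L\<^esub> f (\<rho> y) \<otimes>\<^bsub>L\<^esub> \<phi> v = f s \<otimes>\<^bsub>L\<^esub> (f (\<rho> y) \<otimes>\<^bsub>L\<^esub> \<phi> v)"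
          using s v fc \<phi>c by (simp add: L.m_assoc)
        also have "f (\<rho> y) \<otimes>\<^bsub>L\<^esub> \<phi> v = \<phi> y" using \<phi>T[OF v(3,1)] v(2) by simp
        finally show ?thesis .
      qed
    qed
    \<comment> \<open>The factor y stays on the right, because what is known is left multiplication
      by letters.\<close>
    have words: "\<phi> (word_value G (\<lambda>x. x) w \<otimes> y) = word_value L f w \<otimes>\<^bsub>L\<^esub> \<phi> y"
      if "set w \<subseteq> Y \<union> T" for w
      using that
    proof (induction w)
      case Nil
      then show ?case using xy \<phi>c by simp
    next
      case (Cons s w)
      have sK: "s \<in> K" using Cons.prems YS T by auto
      have "Y \<union> T \<subseteq> K" using YS T by auto
      then have XK: "set w \<subseteq> K" using Cons.prems by auto
      have wK: "word_value G (\<lambda>x. x) w \<in> K" using XK by (induction w) auto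
      have "\<phi> (word_value G (\<lambda>x. x) (s # w) \<otimes> y) = \<phi> (s \<otimes> (word_value G (\<lambda>x. x) w \<otimes> y))"
        using sK wK xy by (simp add: m_assoc)
      also have "\<dots> = f s \<otimes>\<^bsub>L\<^esub> (word_value L f w \<otimes>\<^bsub>L\<^esub> \<phi> y)"
        using Cons wK xy by (simp add: hX)
      also have "\<dots> = word_value L f (s # w) \<otimes>\<^bsub>L\<^esub> \<phi> y"
      proof -
        have "f ` set w \<subseteq> carrier L" using Cons.prems fc by auto
        then show ?thesis
          using Cons.prems fc \<phi>c[OF xy(2)] L.word_value_closed[of f w] by (simp add: L.m_assoc)
      qed
      finally show ?case .
    qed
    show ?thesis using words[OF letters'[OF xy(1)]] val'[OF xy(1)] by (simp add: \<phi>_def)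
  qed
  have "normal_forms G L K (Y \<union> T) nf' (Suc r)"
    unfolding normal_forms_def
  proof (intro conjI ballI allI impI)
    show "Y \<union> T \<subseteq> K" using YS T by auto
    show "nf' \<one> = []" using nf1 by (simp add: nf'_def)
    show "length (nf' k) \<le> Suc r" if "k \<in> K" for k
      using len[of k] len[OF \<rho>(2)[OF that]] by (auto simp: nf'_def)
  qed (use letters' val' nfX hom in auto)
  then show ?thesis using cX pow Y(1) finT by blast
qed

text \<open>Each descent along the chain at least halves the subgroup and contributes at most c
  letters, so the number r of descents is at most the logarithm of card K.\<close>

lemma (in group) exists_normal_forms:
  assumes fin: "finite (carrier G)" and L: "group L"
    and chain: "\<And>S. subgroup S G \<Longrightarrow> S \<noteq> {\<one>} \<Longrightarrow> \<exists>T. subgroup T G \<and> T \<subset> S \<and> card S \<le> c * card T"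
    and K: "subgroup K G"
  shows "\<exists>X nf r. normal_forms G L K X nf r \<and> finite X \<and> card X \<le> c * r \<and> 2 ^ r \<le> card K"
  using K
proof (induction "card K" arbitrary: K rule: less_induct)
  case less
  interpret K: subgroup K G by (rule less.prems)
  interpret L: group L by fact
  have finK: "finite K" using fin K.subset finite_subset by blast
  show ?case
  proof (cases "K = {\<one>}")
    case True
    have "normal_forms G L {\<one>} {} (\<lambda>_. []) 0"
      by (auto simp: normal_forms_def)
    then show ?thesis using True by (intro exI[of _ "{}"] exI[of _ "\<lambda>_. []"] exI[of _ 0]) auto
  next
    case False
    then obtain T where T: "subgroup T G" "T \<subset> K" "card K \<le> c * card T" using chain less.prems by blast
    have "card T < card K" using finK T by (simp add: psubset_card_mono)
    then obtain X nf r where "normal_forms G L T X nf r" "finite X" "card X \<le> c * r" "2 ^ r \<le> card T"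
      using less.hyps T by blast
    then show ?thesis using normal_forms_extend[OF less.prems finK T L] by blast
  qed
qed

section \<open>Flat extensions\<close>

lemma flat_mult [simp]:
  "sr_mult (flat_extension G) (Some a) (Some b) = Some (a \<otimes>\<^bsub>G\<^esub> b)"
  "sr_mult (flat_extension G) None z = None"
  "sr_mult (flat_extension G) z None = None"
  by (simp_all add: flat_extension_def split: option.splits)

lemma flat_meet: "sr_meet (flat_extension G) x y = (if x = y then x else None)"
  by (simp add: flat_extension_def)

lemma flat_carrier [simp]:
  "None \<in> carrier (flat_extension G)"
  "Some a \<in> carrier (flat_extension G) \<longleftrightarrow> a \<in> carrier G"
  by (auto simp: flat_extension_def)

lemma (in group) is_alg_flat: "is_alg (flat_extension G)"
  by (auto simp: is_alg_def flat_extension_def)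

lemma (in group) additive_idempotent_semiring_flat: "additive_idempotent_semiring (flat_extension G)"
  unfolding additive_idempotent_semiring_def
proof (intro conjI ballI)
  fix x y z assume "x \<in> carrier (flat_extension G)" "y \<in> carrier (flat_extension G)" "z \<in> carrier (flat_extension G)"
  then show
    "sr_mult (flat_extension G) (sr_mult (flat_extension G) x y) z =
      sr_mult (flat_extension G) x (sr_mult (flat_extension G) y z)"
    "sr_mult (flat_extension G) x (sr_meet (flat_extension G) y z) =
      sr_meet (flat_extension G) (sr_mult (flat_extension G) x y) (sr_mult (flat_extension G) x z)"
    "sr_mult (flat_extension G) (sr_meet (flat_extension G) x y) z =
      sr_meet (flat_extension G) (sr_mult (flat_extension G) x z) (sr_mult (flat_extension G) y z)"
    by (cases x; cases y; cases z; auto simp: flat_meet m_assoc)+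
qed (auto simp: is_alg_flat flat_meet)

section \<open>Equations and varieties\<close>

definition equations_up_to :: "'a sr_alg \<Rightarrow> nat \<Rightarrow> 'b sr_alg \<Rightarrow> bool" where
  "equations_up_to A l B \<longleftrightarrow>
     (\<forall>u v :: nat sr_term. satisfies A u v \<longrightarrow> equation_length u v \<le> l \<longrightarrow> satisfies B u v)"

lemma eval_map_term: "eval_term A e (map_sr_term \<rho> t) = eval_term A (e \<circ> \<rho>) t"
  by (induction t) auto

lemma term_length_map [simp]: "term_length (map_sr_term \<rho> t) = term_length t"
  by (induction t) auto

lemma finite_set_sr_term [simp]: "finite (set_sr_term t)"
  by (induction t) auto

lemma eval_term_cong': "(\<And>x. x \<in> set_sr_term t \<Longrightarrow> e x = e' x) \<Longrightarrow> eval_term A e t = eval_term A e' t"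
  by (rule eval_term_cong) auto

text \<open>Later terms use tagged indices or elements of B as variables; a single equation has
  finitely many, which are renamed injectively into \<open>nat\<close>.\<close>

lemma equations_up_to_any_variables:
  fixes u v :: "'v sr_term"
  assumes "equations_up_to A l B" "satisfies A u v" "equation_length u v \<le> l" and ne: "is_alg B"
  shows "satisfies B u v"
proof -
  define V where "V = set_sr_term u \<union> set_sr_term v"
  have "finite V" by (simp add: V_def)
  then obtain \<rho> :: "'v \<Rightarrow> nat" where \<rho>: "inj_on \<rho> V"
    using finite_imp_inj_to_nat_seg by blast
  have "satisfies A (map_sr_term \<rho> u) (map_sr_term \<rho> v)"
    unfolding satisfies_def eval_map_term
  proof (intro allI impI)
    fix e :: "nat \<Rightarrow> 'a" assume "range e \<subseteq> carrier A"
    then have "range (e \<circ> \<rho>) \<subseteq> carrier A" by auto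
    then show "eval_term A (e \<circ> \<rho>) u = eval_term A (e \<circ> \<rho>) v"
      using assms(2) unfolding satisfies_def by blast
  qed
  then have B: "satisfies B (map_sr_term \<rho> u) (map_sr_term \<rho> v)"
    using assms(1,3) by (auto simp: equations_up_to_def equation_length_def)
  obtain b where b: "b \<in> carrier B" using ne by (auto simp: is_alg_def)
  show ?thesis
    unfolding satisfies_def
  proof (intro allI impI)
    fix e :: "'v \<Rightarrow> 'b" assume e: "range e \<subseteq> carrier B"
    define e' where "e' i = (if i \<in> \<rho> ` V then e (inv_into V \<rho> i) else b)" for i
    have "range e' \<subseteq> carrier B" using e b by (auto simp: e'_def)
    then have "eval_term B (e' \<circ> \<rho>) u = eval_term B (e' \<circ> \<rho>) v"
      using B by (auto simp: satisfies_def eval_map_term)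
    moreover have "(e' \<circ> \<rho>) x = e x" if "x \<in> V" for x using that \<rho> by (simp add: e'_def)
    ultimately show "eval_term B e u = eval_term B e v"
      using eval_term_cong'[of u "e' \<circ> \<rho>" e B] eval_term_cong'[of v "e' \<circ> \<rho>" e B] by (simp add: V_def)
  qed
qed

text \<open>Birkhoff's argument: the term functions on all assignments form a free algebra inside a
  power of A. As B lives on \<open>nat\<close>, its elements serve as names of the generators that
  map onto them.\<close>

lemma in_variety_if_satisfies:
  fixes A :: "'a sr_alg" and B :: "nat sr_alg"
  assumes A: "is_alg A" and B: "is_alg B"
    and eqs: "\<And>u v :: nat sr_term. satisfies A u v \<Longrightarrow> satisfies B u v"
  shows "in_variety A B"
proof -
  define J :: "(nat \<Rightarrow> 'a) set" where "J = {e. range e \<subseteq> carrier A}"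
  define F where "F t = (\<lambda>e\<in>J. eval_term A e t)" for t
  define P where "P = power_alg J A"
  obtain b where b: "b \<in> carrier B" using B by (auto simp: is_alg_def)
  define g where "g i = (if i \<in> carrier B then i else b)" for i
  have g: "range g \<subseteq> carrier B" using b by (auto simp: g_def)
  have key: "eval_term B g s = eval_term B g t" if "F s = F t" for s t
  proof -
    have "satisfies A s t" unfolding satisfies_def
    proof (intro allI impI)
      fix e :: "nat \<Rightarrow> 'a" assume "range e \<subseteq> carrier A"
      then show "eval_term A e s = eval_term A e t" using fun_cong[OF that, of e] by (simp add: F_def J_def)
    qed
    then show ?thesis using eqs g unfolding satisfies_def by blast
  qed
  define S where "S = \<lparr>carrier = range F, sr_mult = sr_mult P, sr_meet = sr_meet P\<rparr>"
  define k where "k f = eval_term B g (SOME t. F t = f)" for f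
  have k: "k (F t) = eval_term B g t" for t
    unfolding k_def by (rule key, rule someI[of _ t]) simp
  have Fm: "sr_mult P (F s) (F t) = F (Mult s t)" "sr_meet P (F s) (F t) = F (Meet s t)" for s t
    by (auto simp: P_def power_alg_def F_def)
  have "F t \<in> carrier P" for t
    using eval_term_closed[OF A, of t] by (auto simp: P_def power_alg_def F_def J_def PiE_iff subset_iff)
  then have sub: "subalgebra S P"
    by (auto simp: subalgebra_def S_def is_alg_def Fm)
  have kB: "eval_term B g t \<in> carrier B" for t
    using g by (intro eval_term_closed[OF B]) auto
  have hom: "k \<in> alg_hom S B" using kB by (auto simp: alg_hom_def S_def Fm k)
  have "i \<in> k ` carrier S" if "i \<in> carrier B" for i
  proof -
    have "i = k (F (Var i))" using that by (simp add: k g_def)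
    then show ?thesis by (auto simp: S_def)
  qed
  then have "k ` carrier S = carrier B" using kB by (auto simp: S_def k)
  with sub hom B show ?thesis
    unfolding in_variety_def in_HSP_def P_def by blast
qed

section \<open>Horn rules as equations\<close>

text \<open>The exponent is shifted by one: \<open>alg_pow A x k\<close> has k + 1 factors, as there
  is no unit to start from.\<close>

primrec alg_pow :: "'a sr_alg \<Rightarrow> 'a \<Rightarrow> nat \<Rightarrow> 'a" where
  "alg_pow A x 0 = x"
| "alg_pow A x (Suc k) = sr_mult A (alg_pow A x k) x"

primrec term_pow :: "'v sr_term \<Rightarrow> nat \<Rightarrow> 'v sr_term" where
  "term_pow t 0 = t"
| "term_pow t (Suc k) = Mult (term_pow t k) t"

lemma eval_term_pow [simp]: "eval_term A e (term_pow t k) = alg_pow A (eval_term A e t) k"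
  by (induction k) auto

lemma term_length_pow: "term_length (term_pow t k) = Suc k * term_length t + k"
  by (induction k) auto

lemma alg_pow_None [simp]: "alg_pow (flat_extension G) None k = None"
  by (induction k) auto

lemma (in group) alg_pow_Some: "a \<in> carrier G \<Longrightarrow> alg_pow (flat_extension G) (Some a) k = Some (a [^] Suc k)"
  by (induction k) auto

text \<open>For \<open>Suc k = 2 * order G\<close>, the value of \<open>guard k t\<close> in the flat extension is that of the extra
  variable \<^const>\<open>None\<close> if \<open>t\<close> has a value in \<open>G\<close>, and the absorbing element otherwise.\<close>
definition guard :: "nat \<Rightarrow> 'v sr_term \<Rightarrow> 'v option sr_term" where
  "guard k t = Mult (Var None) (term_pow (map_sr_term Some t) k)"

definition horn_lhs :: "nat \<Rightarrow> 'v sr_term list \<Rightarrow> 'v option sr_term" where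
  "horn_lhs k ts = foldr (\<lambda>t acc. Meet acc (guard k t)) ts (Var None)"

definition horn_length :: "nat \<Rightarrow> 'v sr_term list \<Rightarrow> 'v sr_term \<Rightarrow> nat" where
  "horn_length k ts t = equation_length (horn_lhs k ts) (Meet (horn_lhs k ts) (guard k t))"

text \<open>Being nonzero plays the role of truth; an identity s = t between group elements is
  expressed by \<open>Meet s t\<close> being nonzero.\<close>

definition flat_rule :: "('a, 'm) monoid_scheme \<Rightarrow> 'v sr_term list \<Rightarrow> 'v sr_term \<Rightarrow> bool" where
  "flat_rule G ts t \<longleftrightarrow> (\<forall>e. range e \<subseteq> carrier (flat_extension G) \<longrightarrow>
     (\<forall>s\<in>set ts. eval_term (flat_extension G) e s \<noteq> None) \<longrightarrow> eval_term (flat_extension G) e t \<noteq> None)"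

text \<open>The premises occur on both sides of the equation, whence the factor 2.\<close>

lemma horn_length_eq:
  "horn_length k ts t =
     2 * (1 + (\<Sum>s\<leftarrow>ts. Suc k * (term_length s + 1) + 2)) + Suc k * (term_length t + 1) + 2"
proof -
  have g: "term_length (guard k t) = Suc k * (term_length t + 1) + 1" for t :: "'v sr_term"
    by (simp add: guard_def term_length_pow)
  have "term_length (horn_lhs k ts) = 1 + (\<Sum>s\<leftarrow>ts. Suc k * (term_length s + 1) + 2)"
    unfolding horn_lhs_def by (induction ts) (auto simp: g)
  then show ?thesis by (simp add: horn_length_def equation_length_def g)
qed

text \<open>If all premises are nonzero, the left side and the guard of the conclusion both have the
  value of the fresh variable; otherwise both sides are 0.\<close>

lemma (in group) satisfies_horn:
  fixes ts :: "'v sr_term list"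
  assumes k: "Suc k = 2 * order G" and rule: "flat_rule G ts t"
  shows "satisfies (flat_extension G) (horn_lhs k ts) (Meet (horn_lhs k ts) (guard k t))"
  unfolding satisfies_def
proof (intro allI impI)
  fix e :: "'v option \<Rightarrow> 'a option" assume e: "range e \<subseteq> carrier (flat_extension G)"
  define A where "A = flat_extension G"
  have eS: "range (\<lambda>x. e (Some x)) \<subseteq> carrier A" using e by (auto simp: A_def)
  have one: "x [^] Suc k = \<one>" if "x \<in> carrier G" for x
    using that by (simp add: k nat_pow_pow[symmetric] mult.commute[of 2] pow_order_eq_1 del: nat_pow_Suc)
  have mt: "sr_meet A x y = (if x = y then x else None)" for x y by (simp add: A_def flat_meet)
  have g: "eval_term A e (guard k s) = (if eval_term A (\<lambda>x. e (Some x)) s = None then None else e None)" for s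
  proof (cases "eval_term A (\<lambda>x. e (Some x)) s")
    case None
    then show ?thesis by (simp add: guard_def eval_map_term comp_def A_def)
  next
    case (Some x)
    have "eval_term A (\<lambda>x. e (Some x)) s \<in> carrier A"
      using eS is_alg_flat by (intro eval_term_closed) (auto simp: A_def)
    then have x: "x \<in> carrier G" using Some by (simp add: A_def)
    have "e None \<in> carrier A" using e by (auto simp: A_def)
    then show ?thesis using Some x one[OF x]
      by (cases "e None") (auto simp: guard_def eval_map_term comp_def A_def alg_pow_Some simp del: nat_pow_Suc)
  qed
  have l: "eval_term A e (horn_lhs k ts) = (if \<exists>s\<in>set ts. eval_term A (\<lambda>x. e (Some x)) s = None then None else e None)"
    unfolding horn_lhs_def by (induction ts) (simp_all add: g mt del: not_None_eq)
  have "eval_term A e (horn_lhs k ts) = eval_term A e (Meet (horn_lhs k ts) (guard k t))"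
    using rule[unfolded flat_rule_def, folded A_def, rule_format, OF eS]
    by (auto simp: l g mt simp del: not_None_eq)
  then show "eval_term (flat_extension G) e (horn_lhs k ts) = eval_term (flat_extension G) e (Meet (horn_lhs k ts) (guard k t))"
    by (simp add: A_def)
qed

lemma flat_mult_eq_None [simp]:
  "sr_mult (flat_extension G) a b = None \<longleftrightarrow> a = None \<or> b = None"
  by (cases a; cases b) auto

lemma flat_meet_eq_None [simp]:
  "sr_meet (flat_extension G) a b = None \<longleftrightarrow> (a = b \<longrightarrow> a = None)"
  by (auto simp: flat_meet)

lemma alg_pow_eq_None [simp]: "alg_pow (flat_extension G) a k = None \<longleftrightarrow> a = None"
  by (induction k) auto

text \<open>These facts make \<open>D\<close> modulo \<open>rel\<close> a group: products and
  factors of nonzero elements are nonzero, agreement is a congruence, multiplication is associative,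
  and the powers with exponent 2|G| are one common left identity.\<close>

definition base_rules :: "nat \<Rightarrow> (nat sr_term list \<times> nat sr_term) list" where
  "base_rules k = (let x = Var 0; y = Var 1; z = Var 2; w = Var 3 in
    [([x, y], Mult x y), ([Mult x y], x), ([Mult x y], y),
     ([x], Meet x x), ([Meet x y], x), ([Meet x y], Meet y x),
     ([Meet x y, Meet y z], Meet x z), ([Meet x y], Meet (Meet x y) x),
     ([Meet x y, Meet z w], Meet (Mult x z) (Mult y w)),
     ([x, y, z], Meet (Mult (Mult x y) z) (Mult x (Mult y z))),
     ([x, y], Meet (Mult (term_pow x k) y) y),
     ([x, y], Meet (term_pow x k) (term_pow y k))])"

text \<open>The second equation puts p into \<open>D\<close>. The third leads from \<open>D\<close>
  back to an inequality in B: for z = p and \<open>Meet z w\<close> in \<open>D\<close>, the term c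
  has the value p, so p lies below w.\<close>

definition base_equations :: "nat \<Rightarrow> (nat sr_term \<times> nat sr_term) list" where
  "base_equations k = (let z = Var 0; w = Var 1; c = Meet z (Mult z (term_pow (Meet z w) k)) in
    [(Meet z w, Meet w z), (z, Meet z (Mult z (term_pow z k))), (c, Meet c w)])"

definition base_length :: "nat \<Rightarrow> nat" where
  "base_length k = (\<Sum>(ts, t)\<leftarrow>base_rules k. horn_length k ts t) +
     (\<Sum>(u, v)\<leftarrow>base_equations k. equation_length u v)"

lemma (in group) alg_pow_flat:
  assumes "Suc k = 2 * order G" "x \<in> carrier (flat_extension G)"
  shows "alg_pow (flat_extension G) x k = (if x = None then None else Some \<one>)"
proof (cases x)
  case (Some a)
  then have "a \<in> carrier G" using assms by simp
  moreover have "a [^] Suc k = \<one>"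
    using \<open>a \<in> carrier G\<close>
    by (simp add: assms(1) nat_pow_pow[symmetric] mult.commute[of 2] pow_order_eq_1 del: nat_pow_Suc)
  ultimately show ?thesis using Some by (simp add: alg_pow_Some del: nat_pow_Suc)
qed simp

lemma (in group) flat_rule_base:
  assumes k: "Suc k = 2 * order G" and "(ts, t) \<in> set (base_rules k)"
  shows "flat_rule G ts t"
  unfolding flat_rule_def
proof (intro allI impI)
  fix e :: "nat \<Rightarrow> 'a option"
  assume e: "range e \<subseteq> carrier (flat_extension G)"
    and prem: "\<forall>s\<in>set ts. eval_term (flat_extension G) e s \<noteq> None"
  have c: "e i \<in> carrier (flat_extension G)" for i using e by auto
  have S: "a \<in> carrier G" if "e i = Some a" for i a using c[of i] that by simp
  have p: "alg_pow (flat_extension G) (e i) k = (if e i = None then None else Some \<one>)" for i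
    using k c by (rule alg_pow_flat)
  have one: "sr_mult (flat_extension G) (Some \<one>) (e i) = e i" for i
    using S[of i] by (cases "e i") auto
  have assoc: "sr_mult (flat_extension G) (sr_mult (flat_extension G) (e i) (e j)) (e l) =
      sr_mult (flat_extension G) (e i) (sr_mult (flat_extension G) (e j) (e l))" for i j l
    using S[of i] S[of j] S[of l] by (cases "e i"; cases "e j"; cases "e l") (auto simp: m_assoc)
  show "eval_term (flat_extension G) e t \<noteq> None"
    using assms(2) prem unfolding base_rules_def Let_def
    by (auto simp: p one assoc flat_meet simp del: not_None_eq split: if_splits)
qed

lemma (in group) satisfies_base:
  assumes k: "Suc k = 2 * order G" and "(u, v) \<in> set (base_equations k)"
  shows "satisfies (flat_extension G) u v"
  unfolding satisfies_def
proof (intro allI impI)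
  fix e :: "nat \<Rightarrow> 'a option"
  assume e: "range e \<subseteq> carrier (flat_extension G)"
  have c: "e i \<in> carrier (flat_extension G)" for i using e by auto
  have p: "alg_pow (flat_extension G) (e i) k = (if e i = None then None else Some \<one>)" for i
    using k c by (rule alg_pow_flat)
  have one: "sr_mult (flat_extension G) (e i) (Some \<one>) = e i" for i
    using c[of i] by (cases "e i") auto
  show "eval_term (flat_extension G) e u = eval_term (flat_extension G) e v"
    using assms(2) unfolding base_equations_def Let_def
    by (auto simp: p one flat_meet)
qed

section \<open>Terms without meet, evaluated in a group and in its flat extension\<close>

primrec meet_free :: "'v sr_term \<Rightarrow> bool" where
  "meet_free (Var x) \<longleftrightarrow> True"
| "meet_free (Mult s t) \<longleftrightarrow> meet_free s \<and> meet_free t"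
| "meet_free (Meet s t) \<longleftrightarrow> False"

text \<open>The value on \<^const>\<open>Meet\<close> is junk.\<close>
primrec group_value :: "('a, 'm) monoid_scheme \<Rightarrow> ('v \<Rightarrow> 'a) \<Rightarrow> 'v sr_term \<Rightarrow> 'a" where
  "group_value L f (Var x) = f x"
| "group_value L f (Mult s t) = group_value L f s \<otimes>\<^bsub>L\<^esub> group_value L f t"
| "group_value L f (Meet s t) = \<one>\<^bsub>L\<^esub>"

lemma meet_free_pow [simp]: "meet_free (term_pow t k) \<longleftrightarrow> meet_free t"
  by (induction k) auto

lemma (in group) group_value_closed: "f ` set_sr_term t \<subseteq> carrier G \<Longrightarrow> group_value G f t \<in> carrier G"
  by (induction t) auto

lemma (in group) group_value_pow:
  "f ` set_sr_term t \<subseteq> carrier G \<Longrightarrow> group_value G f (term_pow t k) = group_value G f t [^] Suc k"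
  using group_value_closed[of f t] by (induction k) auto

lemma set_term_pow [simp]: "set_sr_term (term_pow t k) = set_sr_term t"
  by (induction k) auto

lemma group_value_cong:
  "(\<And>x. x \<in> set_sr_term t \<Longrightarrow> f x = g x) \<Longrightarrow> group_value L f t = group_value L g t"
  by (induction t) auto

lemma eval_flat_meet_free:
  assumes "meet_free t"
  shows "eval_term (flat_extension G) e t =
    (if \<exists>x\<in>set_sr_term t. e x = None then None else Some (group_value G (\<lambda>x. the (e x)) t))"
  using assms by (induction t) auto

section \<open>The group at a point of an algebra\<close>

text \<open>Nothing is known of B beyond the short equations that it shares with the flat extension;
  even associativity is available only modulo \<open>rel\<close>. The point p will be the value of
  one side of the equation under test.\<close>

locale flat_model = group G for G :: "('a, 'm) monoid_scheme" (structure) +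
  fixes B :: "'b sr_alg" and l k :: nat and p :: 'b
  assumes finG: "finite (carrier G)" and k: "Suc k = 2 * order G"
    and algB: "is_alg B" and finB: "finite (carrier B)"
    and eqs: "equations_up_to (flat_extension G) l B" and base: "base_length k \<le> l"
    and p: "p \<in> carrier B"
begin

definition D :: "'b set" where
  "D = {b \<in> carrier B. sr_meet B p (sr_mult B p (alg_pow B b k)) = p}"

definition rel :: "'b \<Rightarrow> 'b \<Rightarrow> bool" where
  "rel x y \<longleftrightarrow> sr_meet B x y \<in> D"

text \<open>Classes are represented by chosen elements, so that the quotient stays inside the
  carrier of B and inherits its bound on cardinality.\<close>

definition rep :: "'b \<Rightarrow> 'b" where
  "rep x = (SOME y. y \<in> D \<and> rel x y)"

definition quotient_group :: "'b monoid" where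
  "quotient_group = \<lparr>carrier = rep ` D, monoid.mult = (\<lambda>x y. rep (sr_mult B x y)), one = rep (alg_pow B p k)\<rparr>"

section \<open>Transfer of Horn rules and equations to B\<close>

lemma closed [simp]:
  "x \<in> carrier B \<Longrightarrow> y \<in> carrier B \<Longrightarrow> sr_mult B x y \<in> carrier B"
  "x \<in> carrier B \<Longrightarrow> y \<in> carrier B \<Longrightarrow> sr_meet B x y \<in> carrier B"
  "x \<in> carrier B \<Longrightarrow> alg_pow B x j \<in> carrier B"
proof -
  show *: "x \<in> carrier B \<Longrightarrow> y \<in> carrier B \<Longrightarrow> sr_mult B x y \<in> carrier B"
    "x \<in> carrier B \<Longrightarrow> y \<in> carrier B \<Longrightarrow> sr_meet B x y \<in> carrier B" for x y
    using algB by (auto simp: is_alg_def)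
  show "x \<in> carrier B \<Longrightarrow> alg_pow B x j \<in> carrier B" by (induction j) (auto simp: *)
qed

text \<open>Evaluating the fresh variable at p collapses the left side to p; the equation then says
  that the guard of the conclusion lies above p.\<close>

lemma horn:
  fixes ts :: "'v sr_term list"
  assumes rl: "flat_rule G ts t" and len: "horn_length k ts t \<le> l"
    and e: "range e \<subseteq> carrier B" and prem: "\<And>s. s \<in> set ts \<Longrightarrow> eval_term B e s \<in> D"
  shows "eval_term B e t \<in> D"
proof -
  define e' where "e' = case_option p e"
  have e': "range e' \<subseteq> carrier B"
  proof (rule image_subsetI)
    fix x show "e' x \<in> carrier B" using e p by (cases x) (auto simp: e'_def)
  qed
  have [simp]: "e' \<circ> Some = e" "e' None = p" by (auto simp: e'_def)
  have g: "sr_meet B p (eval_term B e' (guard k s)) = p \<longleftrightarrow> eval_term B e s \<in> D" for s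
  proof -
    have "eval_term B e s \<in> carrier B" using e by (intro eval_term_closed[OF algB]) auto
    then show ?thesis by (simp add: guard_def eval_map_term D_def)
  qed
  have lhs: "eval_term B e' (horn_lhs k ts) = p"
    using prem unfolding horn_lhs_def by (induction ts) (auto simp: g)
  have sat: "satisfies B (horn_lhs k ts) (Meet (horn_lhs k ts) (guard k t))"
    using equations_up_to_any_variables[OF eqs satisfies_horn[OF k rl] _ algB] len
    by (simp add: horn_length_def)
  have "eval_term B e' (Meet (horn_lhs k ts) (guard k t)) = p"
    using sat[unfolded satisfies_def, rule_format, OF e'] lhs by (rule trans[OF sym])
  then have "sr_meet B p (eval_term B e' (guard k t)) = p" unfolding eval_term.simps lhs .
  then show ?thesis using g by blast
qed

lemma base_rule:
  assumes "(ts, t) \<in> set (base_rules k)"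
    and "range e \<subseteq> carrier B" "\<forall>s\<in>set ts. eval_term B e s \<in> D"
  shows "eval_term B e t \<in> D"
proof -
  have "horn_length k ts t \<le> (\<Sum>(ts, t)\<leftarrow>base_rules k. horn_length k ts t)"
    using assms(1) by (intro member_le_sum_list; force)
  then have "horn_length k ts t \<le> l" using base by (simp add: base_length_def)
  then show ?thesis using horn[OF flat_rule_base[OF k assms(1)]] assms by blast
qed

lemma base_equation:
  assumes "(u, v) \<in> set (base_equations k)" and e: "range e \<subseteq> carrier B"
  shows "eval_term B e u = eval_term B e v"
proof -
  have "equation_length u v \<le> (\<Sum>(u, v)\<leftarrow>base_equations k. equation_length u v)"
    using assms(1) by (intro member_le_sum_list; force)
  then have "equation_length u v \<le> l" using base by (simp add: base_length_def)
  then show ?thesis using eqs satisfies_base[OF k assms(1)] e by (auto simp: equations_up_to_def satisfies_def)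
qed

definition env :: "'b \<Rightarrow> 'b \<Rightarrow> 'b \<Rightarrow> 'b \<Rightarrow> nat \<Rightarrow> 'b" where
  "env x y z w i = (if i = 0 then x else if i = 1 then y else if i = 2 then z else w)"

lemma env_simps [simp]:
  "env x y z w 0 = x" "env x y z w (Suc 0) = y" "env x y z w 2 = z" "env x y z w 3 = w"
  by (simp_all add: env_def)

lemma range_env: "{x, y, z, w} \<subseteq> carrier B \<Longrightarrow> range (env x y z w) \<subseteq> carrier B"
  by (auto simp: env_def)

lemma base_rule_env:
  assumes "(ts, t) \<in> set (base_rules k)" "{x, y, z, w} \<subseteq> carrier B"
    "\<forall>s\<in>set ts. eval_term B (env x y z w) s \<in> D"
  shows "eval_term B (env x y z w) t \<in> D"
  using base_rule[OF assms(1) range_env[OF assms(2)] assms(3)] .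

lemma base_equation_env:
  assumes "(u, v) \<in> set (base_equations k)" "{x, y, z, w} \<subseteq> carrier B"
  shows "eval_term B (env x y z w) u = eval_term B (env x y z w) v"
  using assms(1) range_env[OF assms(2)] by (rule base_equation)

section \<open>The set \<open>D\<close> and the congruence \<open>rel\<close> on it\<close>

lemma meet_commute:
  assumes "x \<in> carrier B" "y \<in> carrier B"
  shows "sr_meet B x y = sr_meet B y x"
proof -
  have "eval_term B (env x y y y) (Meet (Var 0) (Var 1)) = eval_term B (env x y y y) (Meet (Var 1) (Var 0))"
    using assms by (intro base_equation_env) (auto simp: base_equations_def Let_def)
  then show ?thesis by (simp only: eval_term.simps env_simps One_nat_def)
qed

lemma p_in_D: "p \<in> D"
proof -
  have "eval_term B (env p p p p) (Var 0) =
      eval_term B (env p p p p) (Meet (Var 0) (Mult (Var 0) (term_pow (Var 0) k)))"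
    using p by (intro base_equation_env) (auto simp: base_equations_def Let_def)
  then have "p = sr_meet B p (sr_mult B p (alg_pow B p k))"
    by (simp only: eval_term.simps eval_term_pow env_simps)
  then show ?thesis using p by (simp only: D_def mem_Collect_eq)
qed

lemma p_le:
  assumes "y \<in> carrier B" "sr_meet B p y \<in> D"
  shows "sr_meet B p y = p"
proof -
  define c :: "nat sr_term" where "c = Meet (Var 0) (Mult (Var 0) (term_pow (Meet (Var 0) (Var 1)) k))"
  have "eval_term B (env p y y y) c = eval_term B (env p y y y) (Meet c (Var 1))"
    using p assms by (intro base_equation_env) (auto simp: base_equations_def Let_def c_def)
  moreover have "eval_term B (env p y y y) c = p" using assms by (simp add: c_def D_def)
  ultimately show ?thesis by (simp only: eval_term.simps env_simps One_nat_def)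
qed

lemma D_carrier [simp]: "x \<in> D \<Longrightarrow> x \<in> carrier B"
  by (simp add: D_def)

lemma D_mult:
  assumes "x \<in> D" "y \<in> D"
  shows "sr_mult B x y \<in> D"
proof -
  have "eval_term B (env x y y y) (Mult (Var 0) (Var 1)) \<in> D"
    using assms by (intro base_rule_env[of "[Var 0, Var 1]"]) (simp_all add: base_rules_def Let_def rel_def)
  then show ?thesis by (simp add: rel_def)
qed

lemma D_mult_left:
  assumes "x \<in> carrier B" "y \<in> carrier B" "sr_mult B x y \<in> D"
  shows "x \<in> D"
proof -
  have "eval_term B (env x y y y) (Var 0) \<in> D"
    using assms by (intro base_rule_env[of "[Mult (Var 0) (Var 1)]"]) (simp_all add: base_rules_def Let_def rel_def)
  then show ?thesis by (simp add: rel_def)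
qed

lemma D_mult_right:
  assumes "x \<in> carrier B" "y \<in> carrier B" "sr_mult B x y \<in> D"
  shows "y \<in> D"
proof -
  have "eval_term B (env x y y y) (Var 1) \<in> D"
    using assms by (intro base_rule_env[of "[Mult (Var 0) (Var 1)]"]) (simp_all add: base_rules_def Let_def rel_def)
  then show ?thesis by (simp add: rel_def)
qed

lemma D_mult_iff: "x \<in> carrier B \<Longrightarrow> y \<in> carrier B \<Longrightarrow> sr_mult B x y \<in> D \<longleftrightarrow> x \<in> D \<and> y \<in> D"
  using D_mult D_mult_left D_mult_right by blast

lemma rel_refl:
  assumes "x \<in> D"
  shows "rel x x"
proof -
  have "eval_term B (env x x x x) (Meet (Var 0) (Var 0)) \<in> D"
    using assms by (intro base_rule_env[of "[Var 0]"]) (simp_all add: base_rules_def Let_def rel_def)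
  then show ?thesis by (simp add: rel_def)
qed

lemma rel_D1:
  assumes "x \<in> carrier B" "y \<in> carrier B" "rel x y"
  shows "x \<in> D"
proof -
  have "eval_term B (env x y y y) (Var 0) \<in> D"
    using assms by (intro base_rule_env[of "[Meet (Var 0) (Var 1)]"]) (simp_all add: base_rules_def Let_def rel_def)
  then show ?thesis by (simp add: rel_def)
qed

lemma rel_sym:
  assumes "x \<in> carrier B" "y \<in> carrier B" "rel x y"
  shows "rel y x"
  using assms(3) unfolding rel_def meet_commute[OF assms(2,1)] .

lemma rel_D2: "x \<in> carrier B \<Longrightarrow> y \<in> carrier B \<Longrightarrow> rel x y \<Longrightarrow> y \<in> D"
  using rel_D1[of y x] rel_sym[of x y] by blast

lemma rel_trans:
  assumes "x \<in> carrier B" "y \<in> carrier B" "z \<in> carrier B" "rel x y" "rel y z"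
  shows "rel x z"
proof -
  have "eval_term B (env x y z z) (Meet (Var 0) (Var 2)) \<in> D"
    using assms by (intro base_rule_env[of "[Meet (Var 0) (Var 1), Meet (Var 1) (Var 2)]"]) (simp_all add: base_rules_def Let_def rel_def)
  then show ?thesis by (simp add: rel_def)
qed

lemma rel_meet:
  assumes "x \<in> carrier B" "y \<in> carrier B" "rel x y"
  shows "rel (sr_meet B x y) x"
proof -
  have "eval_term B (env x y y y) (Meet (Meet (Var 0) (Var 1)) (Var 0)) \<in> D"
    using assms by (intro base_rule_env[of "[Meet (Var 0) (Var 1)]"]) (simp_all add: base_rules_def Let_def rel_def)
  then show ?thesis by (simp add: rel_def)
qed

lemma rel_mult:
  assumes "{x, y, z, w} \<subseteq> carrier B" "rel x y" "rel z w"
  shows "rel (sr_mult B x z) (sr_mult B y w)"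
proof -
  have "eval_term B (env x y z w) (Meet (Mult (Var 0) (Var 2)) (Mult (Var 1) (Var 3))) \<in> D"
    using assms by (intro base_rule_env[of "[Meet (Var 0) (Var 1), Meet (Var 2) (Var 3)]"]) (simp_all add: base_rules_def Let_def rel_def)
  then show ?thesis by (simp add: rel_def)
qed

lemma rel_assoc:
  assumes "x \<in> D" "y \<in> D" "z \<in> D"
  shows "rel (sr_mult B (sr_mult B x y) z) (sr_mult B x (sr_mult B y z))"
proof -
  have "eval_term B (env x y z z) (Meet (Mult (Mult (Var 0) (Var 1)) (Var 2)) (Mult (Var 0) (Mult (Var 1) (Var 2)))) \<in> D"
    using assms by (intro base_rule_env[of "[Var 0, Var 1, Var 2]"]) (simp_all add: base_rules_def Let_def rel_def)
  then show ?thesis by (simp add: rel_def)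
qed

lemma rel_pow_mult:
  assumes "x \<in> D" "y \<in> D"
  shows "rel (sr_mult B (alg_pow B x k) y) y"
proof -
  have "eval_term B (env x y y y) (Meet (Mult (term_pow (Var 0) k) (Var 1)) (Var 1)) \<in> D"
    using assms by (intro base_rule_env[of "[Var 0, Var 1]"]) (simp_all add: base_rules_def Let_def rel_def)
  then show ?thesis by (simp add: rel_def)
qed

lemma rel_pow_pow:
  assumes "x \<in> D" "y \<in> D"
  shows "rel (alg_pow B x k) (alg_pow B y k)"
proof -
  have "eval_term B (env x y y y) (Meet (term_pow (Var 0) k) (term_pow (Var 1) k)) \<in> D"
    using assms by (intro base_rule_env[of "[Var 0, Var 1]"]) (simp_all add: base_rules_def Let_def rel_def)
  then show ?thesis by (simp add: rel_def)
qed

section \<open>The group of classes of \<open>D\<close>\<close>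

lemma pow_in_D: "x \<in> D \<Longrightarrow> alg_pow B x j \<in> D"
  by (induction j) (auto simp: D_mult_iff)

lemma rep: assumes "x \<in> D" shows "rep x \<in> D" "rel x (rep x)"
proof -
  have "rep x \<in> D \<and> rel x (rep x)"
    unfolding rep_def by (rule someI[of _ x]) (use assms rel_refl in blast)
  then show "rep x \<in> D" "rel x (rep x)" by auto
qed

lemma rep_eq_iff: assumes "x \<in> D" "y \<in> D" shows "rep x = rep y \<longleftrightarrow> rel x y"
proof
  assume "rep x = rep y"
  then show "rel x y" using rep[of x] rep[of y] assms by (metis D_carrier rel_sym rel_trans)
next
  assume "rel x y"
  then have "rel x z \<longleftrightarrow> rel y z" if "z \<in> D" for z
    using assms that by (meson D_carrier rel_sym rel_trans)
  then have "(\<lambda>z. z \<in> D \<and> rel x z) = (\<lambda>z. z \<in> D \<and> rel y z)" by auto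
  then show "rep x = rep y" by (simp add: rep_def)
qed

lemma rep_rep [simp]: "x \<in> D \<Longrightarrow> rep (rep x) = rep x"
  by (metis rep rep_eq_iff)

lemma rep_mult: assumes "x \<in> D" "y \<in> D"
  shows "rep (sr_mult B (rep x) (rep y)) = rep (sr_mult B x y)"
proof -
  have "rel (sr_mult B x y) (sr_mult B (rep x) (rep y))"
    using rep[OF assms(1)] rep[OF assms(2)] assms by (intro rel_mult) auto
  then show ?thesis using rep_eq_iff[of "sr_mult B x y" "sr_mult B (rep x) (rep y)"] rep assms
    by (simp add: D_mult_iff)
qed

lemma quotient_simps:
  "x \<in> D \<Longrightarrow> rep x \<in> carrier quotient_group"
  "x \<in> D \<Longrightarrow> y \<in> D \<Longrightarrow> rep x \<otimes>\<^bsub>quotient_group\<^esub> rep y = rep (sr_mult B x y)"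
  "x \<in> D \<Longrightarrow> \<one>\<^bsub>quotient_group\<^esub> = rep (alg_pow B x k)"
  "x \<in> carrier quotient_group \<Longrightarrow> x \<in> D"
  "x \<in> carrier quotient_group \<Longrightarrow> rep x = x"
proof -
  show "\<one>\<^bsub>quotient_group\<^esub> = rep (alg_pow B x k)" if "x \<in> D"
    unfolding quotient_group_def monoid.simps
    by (subst rep_eq_iff) (use that p_in_D pow_in_D rel_pow_pow in auto)
qed (use rep(1) in \<open>auto simp: quotient_group_def rep_mult\<close>)

lemma k_pos: "k > 0"
proof -
  have "order G > 0" using finG by (simp add: order_gt_0_iff_finite)
  then show ?thesis using k by presburger
qed

lemma group_quotient: "group quotient_group"
proof (rule groupI)
  note q = quotient_simps
  fix x assume x: "x \<in> carrier quotient_group"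
  note x' = q(4,5)[OF x]
  show "\<one>\<^bsub>quotient_group\<^esub> \<otimes>\<^bsub>quotient_group\<^esub> x = x"
  proof -
    have "rep (alg_pow B x k) \<otimes>\<^bsub>quotient_group\<^esub> rep x = rep (sr_mult B (alg_pow B x k) x)"
      using x' pow_in_D q(2) by blast
    also have "\<dots> = rep x"
      using x' rel_pow_mult pow_in_D by (subst rep_eq_iff) (auto simp: D_mult_iff)
    finally show ?thesis using x' q(3)[of x] by simp
  qed
  \<comment> \<open>The inverse is the power with 2|G| - 1 factors; since k is positive, it is a
    genuine term.\<close>
  have "rep (alg_pow B x (k - 1)) \<otimes>\<^bsub>quotient_group\<^esub> rep x = rep (alg_pow B x (Suc (k - 1)))"
    using x' pow_in_D q(2)[of "alg_pow B x (k - 1)" x] by simp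
  also have "Suc (k - 1) = k" using k_pos by simp
  finally show "\<exists>y\<in>carrier quotient_group. y \<otimes>\<^bsub>quotient_group\<^esub> x = \<one>\<^bsub>quotient_group\<^esub>"
    using x' q(3)[of x] q(1) pow_in_D by auto
  fix y assume y: "y \<in> carrier quotient_group"
  note y' = q(4,5)[OF y]
  show "x \<otimes>\<^bsub>quotient_group\<^esub> y \<in> carrier quotient_group"
    using x' y' q(1)[of "sr_mult B x y"] q(2)[of x y] by (simp add: D_mult_iff)
  fix z assume z: "z \<in> carrier quotient_group"
  note z' = q(4,5)[OF z]
  have "rep x \<otimes>\<^bsub>quotient_group\<^esub> rep y \<otimes>\<^bsub>quotient_group\<^esub> rep z = rep (sr_mult B (sr_mult B x y) z)"
    using x'(1) y'(1) z'(1) by (simp add: q(2) D_mult_iff)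
  also have "\<dots> = rep (sr_mult B x (sr_mult B y z))"
    using x'(1) y'(1) z'(1) rel_assoc by (subst rep_eq_iff) (auto simp: D_mult_iff)
  also have "\<dots> = rep x \<otimes>\<^bsub>quotient_group\<^esub> (rep y \<otimes>\<^bsub>quotient_group\<^esub> rep z)"
    using x'(1) y'(1) z'(1) by (simp add: q(2) D_mult_iff)
  finally show "x \<otimes>\<^bsub>quotient_group\<^esub> y \<otimes>\<^bsub>quotient_group\<^esub> z = x \<otimes>\<^bsub>quotient_group\<^esub> (y \<otimes>\<^bsub>quotient_group\<^esub> z)"
    unfolding x'(2) y'(2) z'(2) .
qed (simp add: quotient_group_def p_in_D pow_in_D)

sublocale Q: group quotient_group by (rule group_quotient)

lemma finite_quotient: "finite (carrier quotient_group)" "card (carrier quotient_group) \<le> card (carrier B)"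
proof -
  have "carrier quotient_group \<subseteq> carrier B" using quotient_simps(4) by auto
  then show "finite (carrier quotient_group)" "card (carrier quotient_group) \<le> card (carrier B)"
    using finB by (auto intro: finite_subset card_mono)
qed

section \<open>From the group of classes back to equations of B\<close>

lemma eval_meet_free:
  assumes "meet_free t" "\<forall>x\<in>set_sr_term t. e x \<in> D"
  shows "eval_term B e t \<in> D \<and> rep (eval_term B e t) = group_value quotient_group (\<lambda>x. rep (e x)) t"
  using assms
proof (induction t)
  case (Mult s t)
  then have "eval_term B e s \<in> D" "eval_term B e t \<in> D"
    "rep (eval_term B e s) = group_value quotient_group (\<lambda>x. rep (e x)) s"
    "rep (eval_term B e t) = group_value quotient_group (\<lambda>x. rep (e x)) t"
    by auto
  then show ?case
    using quotient_simps(2)[of "eval_term B e s" "eval_term B e t"] by (simp add: D_mult_iff)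
next
  case (Var x)
  then show ?case by simp
next
  case (Meet s t)
  then show ?case by simp
qed

text \<open>Each identity becomes a meet required to be nonzero. A nonzero value of a meet-free term
  forces its variables to be nonzero, and \<open>vars\<close> extends this from the premises to the
  conclusion.\<close>

lemma quasi_identity_transfer:
  fixes ps :: "('v sr_term \<times> 'v sr_term) list"
  assumes mf: "\<And>s t. (s, t) \<in> set ps \<Longrightarrow> meet_free s \<and> meet_free t" "meet_free u" "meet_free v"
    and vars: "set_sr_term u \<union> set_sr_term v \<subseteq> (\<Union>(s, t)\<in>set ps. set_sr_term s)"
    and valid: "\<And>f :: 'v \<Rightarrow> 'a. range f \<subseteq> carrier G \<Longrightarrow>
      (\<And>s t. (s, t) \<in> set ps \<Longrightarrow> group_value G f s = group_value G f t) \<Longrightarrow> group_value G f u = group_value G f v"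
    and len: "horn_length k (map (\<lambda>(s, t). Meet s t) ps) (Meet u v) \<le> l"
    and f: "range f \<subseteq> carrier quotient_group"
    and prem: "\<And>s t. (s, t) \<in> set ps \<Longrightarrow> group_value quotient_group f s = group_value quotient_group f t"
  shows "group_value quotient_group f u = group_value quotient_group f v"
proof -
  have "flat_rule G (map (\<lambda>(s, t). Meet s t) ps) (Meet u v)"
    unfolding flat_rule_def
  proof (intro allI impI)
    fix e :: "'v \<Rightarrow> 'a option" assume e: "range e \<subseteq> carrier (flat_extension G)"
      and H: "\<forall>s\<in>set (map (\<lambda>(s, t). Meet s t) ps). eval_term (flat_extension G) e s \<noteq> None"
    have *: "eval_term (flat_extension G) e s = eval_term (flat_extension G) e t"
      "eval_term (flat_extension G) e s \<noteq> None" if "(s, t) \<in> set ps" for s t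
    proof -
      have "Meet s t \<in> set (map (\<lambda>(s, t). Meet s t) ps)"
        unfolding set_map using imageI[OF that, of "\<lambda>(s, t). Meet s t"] by simp
      then have "eval_term (flat_extension G) e (Meet s t) \<noteq> None" using H by (rule bspec[rotated])
      then show "eval_term (flat_extension G) e s = eval_term (flat_extension G) e t"
        "eval_term (flat_extension G) e s \<noteq> None"
        by (simp_all del: not_None_eq)
    qed
    \<comment> \<open>Variables with value 0 are sent to 1 because \<open>valid\<close> speaks of
      total assignments in G; such variables occur in no premise.\<close>
    define f where "f x = (if e x = None then \<one> else the (e x))" for x
    have "f x \<in> carrier G" for x
    proof -
      have "e x \<in> carrier (flat_extension G)" using e by auto
      then show ?thesis by (cases "e x") (auto simp: f_def)
    qed
    then have f: "range f \<subseteq> carrier G" by auto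
    have ev: "eval_term (flat_extension G) e t =
        (if \<exists>x\<in>set_sr_term t. e x = None then None else Some (group_value G f t))" if "meet_free t" for t
    proof -
      have "group_value G (\<lambda>x. the (e x)) t = group_value G f t" if "\<not> (\<exists>x\<in>set_sr_term t. e x = None)"
        using that by (intro group_value_cong) (auto simp: f_def)
      then show ?thesis using eval_flat_meet_free[OF that, of G e] by auto
    qed
    have eq: "group_value G f s = group_value G f t" "\<forall>x\<in>set_sr_term s. e x \<noteq> None" if "(s, t) \<in> set ps" for s t
      using *[OF that] mf(1)[OF that] by (auto simp: ev split: if_splits)
    then have "group_value G f u = group_value G f v" using valid f by blast
    moreover have "\<forall>x\<in>set_sr_term u \<union> set_sr_term v. e x \<noteq> None" using vars eq(2) by blast
    ultimately show "eval_term (flat_extension G) e (Meet u v) \<noteq> None"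
      using mf by (auto simp: ev)
  qed
  moreover have fB: "range f \<subseteq> D" and repf: "(\<lambda>x. rep (f x)) = f"
    using f quotient_simps(4,5) by (auto simp: fun_eq_iff)
  have ev: "eval_term B f t \<in> D" "rep (eval_term B f t) = group_value quotient_group f t" if "meet_free t" for t
    using eval_meet_free[OF that, of f] fB repf by auto
  have "eval_term B f s \<in> D" if s: "s \<in> set (map (\<lambda>(s, t). Meet s t) ps)" for s
  proof -
    obtain a b where ab: "(a, b) \<in> set ps" "s = Meet a b" using s by auto
    then have "rel (eval_term B f a) (eval_term B f b)"
      using prem[OF ab(1)] mf(1)[OF ab(1)] ev by (subst rep_eq_iff[symmetric]) auto
    then show ?thesis using ab by (simp add: rel_def)
  qed
  ultimately have "eval_term B f (Meet u v) \<in> D"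
    using fB by (intro horn[OF _ len]) auto
  then have "rel (eval_term B f u) (eval_term B f v)" by (simp add: rel_def)
  then show ?thesis using ev mf rep_eq_iff by metis
qed

text \<open>Every homomorphism \<phi> into G induces an assignment in the flat extension by
  \<open>ext \<phi>\<close>. A single \<phi> may identify too much at a meet, but a term that is
  nonzero under all of them has its value in \<open>D\<close>, because together they separate
  points. Applied to \<open>Meet u v\<close>, this puts p below the value of v.\<close>

lemma meet_eq_if_separated:
  fixes u v :: "'v sr_term"
  assumes sat: "satisfies (flat_extension G) u v" and e: "range e \<subseteq> carrier B" and pu: "p = eval_term B e u"
    and sep: "\<And>h. h \<in> carrier quotient_group \<Longrightarrow> (\<And>\<phi>. \<phi> \<in> hom quotient_group G \<Longrightarrow> \<phi> h = \<one>) \<Longrightarrow> h = \<one>\<^bsub>quotient_group\<^esub>"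
  shows "sr_meet B p (eval_term B e v) = p"
proof -
  define ext where "ext \<phi> b = (if b \<in> D then Some (\<phi> (rep b)) else None)" for \<phi> :: "'b \<Rightarrow> 'a" and b
  have eC: "eval_term B e t \<in> carrier B" for t :: "'v sr_term"
    using e by (intro eval_term_closed[OF algB]) auto
  have sep': "x = y" if "x \<in> carrier quotient_group" "y \<in> carrier quotient_group"
      "\<And>\<phi>. \<phi> \<in> hom quotient_group G \<Longrightarrow> \<phi> x = \<phi> y" for x y
  proof -
    have "x \<otimes>\<^bsub>quotient_group\<^esub> inv\<^bsub>quotient_group\<^esub> y = \<one>\<^bsub>quotient_group\<^esub>"
    proof (rule sep)
      fix \<phi> assume \<phi>: "\<phi> \<in> hom quotient_group G"
      interpret \<phi>: group_hom quotient_group G \<phi> by unfold_locales (rule \<phi>)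
      show "\<phi> (x \<otimes>\<^bsub>quotient_group\<^esub> inv\<^bsub>quotient_group\<^esub> y) = \<one>"
        using that(1,2) that(3)[OF \<phi>] by simp
    qed (use that in auto)
    then show ?thesis using that by (metis Q.inv_closed Q.inv_equality Q.inv_inv)
  qed
  have hom_closed: "\<phi> (rep b) \<in> carrier G" if "\<phi> \<in> hom quotient_group G" "b \<in> D" for \<phi> b
    using that quotient_simps(1) by (auto simp: hom_def)
  have ext_eval: "eval_term (flat_extension G) (\<lambda>x. ext \<phi> (e x)) t = ext \<phi> (eval_term B e t)"
    if \<phi>: "\<phi> \<in> hom quotient_group G" and "eval_term B e t \<in> D" for \<phi> and t :: "'v sr_term"
    using that(2)
  proof (induction t)
    case (Mult s t)
    then have "eval_term B e s \<in> D" "eval_term B e t \<in> D" using eC by (auto simp: D_mult_iff)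
    moreover from this have "\<phi> (rep (sr_mult B (eval_term B e s) (eval_term B e t))) =
        \<phi> (rep (eval_term B e s)) \<otimes> \<phi> (rep (eval_term B e t))"
      using \<phi> by (simp add: quotient_simps(1) quotient_simps(2)[symmetric] hom_mult)
    ultimately show ?case using Mult by (simp add: ext_def)
  next
    case (Meet s t)
    then have r: "rel (eval_term B e s) (eval_term B e t)" by (simp add: rel_def)
    then have d: "eval_term B e s \<in> D" "eval_term B e t \<in> D" using eC rel_D1 rel_D2 by blast+
    then have "rep (eval_term B e s) = rep (eval_term B e t)" using r rep_eq_iff by simp
    moreover have "rep (eval_term B e (Meet s t)) = rep (eval_term B e s)"
      using rel_meet[OF _ _ r] eC d Meet.prems rep_eq_iff by simp
    ultimately show ?case using Meet d by (simp add: ext_def flat_meet)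
  qed simp
  have eval_D: "eval_term B e t \<in> D"
    if "\<And>\<phi>. \<phi> \<in> hom quotient_group G \<Longrightarrow> eval_term (flat_extension G) (\<lambda>x. ext \<phi> (e x)) t \<noteq> None" for t :: "'v sr_term"
    using that
  proof (induction t)
    case (Var x)
    \<comment> \<open>The trivial homomorphism ensures that the assumption about all \<phi> is not
      vacuous.\<close>
    have "(\<lambda>_. \<one>) \<in> hom quotient_group G" by (auto simp: hom_def)
    then show ?case using Var by (force simp: ext_def split: if_splits)
  next
    case (Mult s t)
    then show ?case using eC by (auto simp: D_mult_iff)
  next
    case (Meet s t)
    then have d: "eval_term B e s \<in> D" "eval_term B e t \<in> D" by auto
    have "\<phi> (rep (eval_term B e s)) = \<phi> (rep (eval_term B e t))" if "\<phi> \<in> hom quotient_group G" for \<phi>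
      using Meet.prems[OF that] ext_eval[OF that] d by (auto simp: ext_def)
    then have "rep (eval_term B e s) = rep (eval_term B e t)"
      using d quotient_simps(1) by (intro sep') auto
    then show ?case using d rep_eq_iff by (simp add: rel_def)
  qed
  have "eval_term B e (Meet u v) \<in> D"
  proof (rule eval_D)
    fix \<phi> assume \<phi>: "\<phi> \<in> hom quotient_group G"
    have "range (\<lambda>x. ext \<phi> (e x)) \<subseteq> carrier (flat_extension G)"
      using hom_closed[OF \<phi>] by (auto simp: ext_def)
    then have "eval_term (flat_extension G) (\<lambda>x. ext \<phi> (e x)) u = eval_term (flat_extension G) (\<lambda>x. ext \<phi> (e x)) v"
      using sat by (auto simp: satisfies_def)
    moreover have "eval_term (flat_extension G) (\<lambda>x. ext \<phi> (e x)) u \<noteq> None"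
      using ext_eval[OF \<phi>, of u] pu p_in_D by (simp add: ext_def)
    ultimately show "eval_term (flat_extension G) (\<lambda>x. ext \<phi> (e x)) (Meet u v) \<noteq> None" by simp
  qed
  then show ?thesis using p_le eC pu by simp
qed

end

section \<open>Short quasi-identities\<close>

definition inv_term :: "nat \<Rightarrow> 'v sr_term \<Rightarrow> 'v sr_term" where
  "inv_term k t = term_pow t (k - 1)"

definition commutator_term :: "nat \<Rightarrow> 'v sr_term \<Rightarrow> 'v sr_term \<Rightarrow> 'v sr_term" where
  "commutator_term k s t = Mult (Mult (Mult s t) (inv_term k s)) (inv_term k t)"

text \<open>The variable \<open>Inl 0\<close> stands for a, \<open>Inl (Suc i)\<close> for x i, and
  \<open>Inr q\<close> for y q.\<close>

primrec iterated_commutator_term :: "nat \<Rightarrow> (nat \<times> nat) list \<Rightarrow> (nat + nat \<times> nat) sr_term" where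
  "iterated_commutator_term k [] = Var (Inl 0)"
| "iterated_commutator_term k (q # qs) =
     commutator_term k (iterated_commutator_term k qs)
       (Mult (Mult (Var (Inr q)) (Mult (Var (Inl (Suc (fst q)))) (inv_term k (Var (Inl (Suc (snd q)))))))
         (inv_term k (Var (Inr q))))"

lemma meet_free_iterated_commutator: "meet_free (iterated_commutator_term k qs)"
  by (induction qs) (auto simp: commutator_term_def inv_term_def)

lemma (in group) group_value_inv_term:
  assumes "range f \<subseteq> carrier G" "k > 0" and pow: "\<And>x. x \<in> carrier G \<Longrightarrow> x [^] Suc k = \<one>"
  shows "group_value G f (inv_term k t) = inv (group_value G f t)"
proof -
  have c: "group_value G f t \<in> carrier G" using assms(1) by (intro group_value_closed) auto
  have "group_value G f (inv_term k t) = group_value G f t [^] k"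
    using assms(1,2) by (simp add: inv_term_def group_value_pow image_subset_iff del: nat_pow_Suc)
  moreover have "group_value G f t [^] k \<otimes> group_value G f t = \<one>" using pow[OF c] by simp
  ultimately show ?thesis using c by (metis inv_equality nat_pow_closed)
qed

lemma (in group) group_value_iterated_commutator:
  assumes "range f \<subseteq> carrier G" "k > 0" and pow: "\<And>x. x \<in> carrier G \<Longrightarrow> x [^] Suc k = \<one>"
  shows "group_value G f (iterated_commutator_term k qs) =
    iterated_commutator G (f (Inl 0)) (\<lambda>i. f (Inl (Suc i))) (\<lambda>q. f (Inr q)) qs"
  by (induction qs) (simp_all add: commutator_term_def commutator_def group_value_inv_term[OF assms])

text \<open>Without a constant, w = 1 is written as w w = w; the trivial premise w = w only ensures
  that all variables are nonzero.\<close>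

definition law_length :: "nat \<Rightarrow> nat \<Rightarrow> nat" where
  "law_length k m = (let w = iterated_commutator_term k (index_pairs m) in
     horn_length k [Meet w w] (Meet (Mult w w) w))"

text \<open>There are at most (Suc k r)^2 relations, each costing at most (Suc k (2 k + 8) + 2) r
  symbols and occurring on both sides; the other summands pay for the constant part and the
  conclusion. Lower powers of r are absorbed by r^3, as r \<ge> 1.\<close>

definition relation_factor :: "nat \<Rightarrow> nat" where
  "relation_factor k = 2 * Suc k ^ 2 * (Suc k * (2 * k + 8) + 2) + 4 + Suc k * (6 * k + 12)"

text \<open>The trailing power of the letter \<open>s\<^sub>0\<close> evaluates to the identity; it makes the empty
  word expressible in a signature without constants.\<close>
definition word_term :: "nat \<Rightarrow> 'v \<Rightarrow> 'v list \<Rightarrow> 'v sr_term" where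
  "word_term k s0 xs = foldr (\<lambda>s t. Mult (Var s) t) xs (term_pow (Var s0) k)"

lemma meet_free_word_term: "meet_free (word_term k s0 xs)"
  unfolding word_term_def by (induction xs) auto

lemma set_word_term: "set_sr_term (word_term k s0 xs) = insert s0 (set xs)"
  unfolding word_term_def by (induction xs) auto

lemma term_length_word_term: "term_length (word_term k s0 xs) = 2 * length xs + 2 * k + 1"
  unfolding word_term_def by (induction xs) (auto simp: term_length_pow)

lemma (in group) group_value_word_term:
  assumes "range f \<subseteq> carrier G" and pow: "\<And>x. x \<in> carrier G \<Longrightarrow> x [^] Suc k = \<one>"
  shows "group_value G f (word_term k s0 xs) = word_value G f xs"
proof -
  have "f s0 \<in> carrier G" using assms(1) by auto
  then have "f s0 [^] Suc k = \<one>" by (rule pow)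
  then show ?thesis unfolding word_term_def using assms(1)
    by (induction xs) (auto simp: group_value_pow image_subset_iff simp del: nat_pow_Suc)
qed

lemma word_value_cong: "(\<And>s. s \<in> set xs \<Longrightarrow> f s = g s) \<Longrightarrow> word_value L f xs = word_value L g xs"
  by (induction xs) auto

section \<open>Separation of the group of classes by homomorphisms into G\<close>

context flat_model
begin

lemma pow_G: "x \<in> carrier G \<Longrightarrow> x [^] Suc k = \<one>"
  by (simp add: k nat_pow_pow[symmetric] mult.commute[of 2] pow_order_eq_1 del: nat_pow_Suc)

lemma quotient_pow:
  assumes "x \<in> carrier quotient_group"
  shows "x [^]\<^bsub>quotient_group\<^esub> Suc k = \<one>\<^bsub>quotient_group\<^esub>"
proof -
  have x: "x \<in> D" "rep x = x" using assms quotient_simps by auto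
  have "rep x [^]\<^bsub>quotient_group\<^esub> Suc j = rep (alg_pow B x j)" for j
  proof (induction j)
    case 0
    show ?case using assms x by simp
  next
    case (Suc j)
    then show ?case using x(1) pow_in_D[of x j] quotient_simps(2)[of "alg_pow B x j" x] by simp
  qed
  then show ?thesis using quotient_simps(3)[OF x(1)] x(2) by simp
qed

lemma bounding_law_quotient:
  assumes len: "law_length k (order G) \<le> l"
  shows "bounding_law quotient_group (order G)"
  unfolding bounding_law_def
proof (intro allI impI)
  fix a and x :: "nat \<Rightarrow> 'b" and y :: "nat \<times> nat \<Rightarrow> 'b"
  assume *: "a \<in> carrier quotient_group" "range x \<subseteq> carrier quotient_group" "range y \<subseteq> carrier quotient_group"
  define w where "w = iterated_commutator_term k (index_pairs (order G))"
  define f where "f = case_sum (case_nat a x) y"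
  have f: "range f \<subseteq> carrier quotient_group"
  proof (rule image_subsetI)
    fix v show "f v \<in> carrier quotient_group"
      using * by (auto simp: f_def split: sum.splits nat.splits)
  qed
  have "group_value quotient_group f (Mult w w) = group_value quotient_group f w"
  proof (rule quasi_identity_transfer[of "[(w, w)]" _ _ f])
    fix g :: "nat + nat \<times> nat \<Rightarrow> 'a" assume g: "range g \<subseteq> carrier G"
    have "group_value G g w =
        iterated_commutator G (g (Inl 0)) (\<lambda>i. g (Inl (Suc i))) (\<lambda>q. g (Inr q)) (index_pairs (order G))"
      unfolding w_def using g k_pos pow_G by (rule group_value_iterated_commutator)
    also have "\<dots> = \<one>"
      by (rule bounding_law_order[OF finG, unfolded bounding_law_def, rule_format]) (use g in auto)
    finally have "group_value G g w = \<one>" .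
    then show "group_value G g (Mult w w) = group_value G g w" by simp
  qed (use len f in \<open>auto simp: w_def meet_free_iterated_commutator law_length_def Let_def\<close>)
  moreover have "group_value quotient_group f w \<in> carrier quotient_group"
    using f by (intro Q.group_value_closed) auto
  ultimately have "group_value quotient_group f w = \<one>\<^bsub>quotient_group\<^esub>" by simp
  moreover have "group_value quotient_group f w = iterated_commutator quotient_group
      (f (Inl 0)) (\<lambda>i. f (Inl (Suc i))) (\<lambda>q. f (Inr q)) (index_pairs (order G))"
    unfolding w_def using f k_pos quotient_pow by (rule Q.group_value_iterated_commutator)
  ultimately show "iterated_commutator quotient_group a x y (index_pairs (order G)) = \<one>\<^bsub>quotient_group\<^esub>"
    by (simp add: f_def)
qed

text \<open>The law and the exponent pass to the subgroup S; the two resulting bounds on the index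
  are |G| and 2|G|, the larger of which is \<open>Suc k\<close>.\<close>

lemma quotient_chain:
  assumes len: "law_length k (order G) \<le> l" and S: "subgroup S quotient_group" "S \<noteq> {\<one>\<^bsub>quotient_group\<^esub>}"
  shows "\<exists>T. subgroup T quotient_group \<and> T \<subset> S \<and> card S \<le> Suc k * card T"
proof -
  interpret S: subgroup S quotient_group by fact
  define K where "K = quotient_group\<lparr>carrier := S\<rparr>"
  interpret K: group K unfolding K_def by (rule S.subgroup_is_group[OF group_quotient])
  interpret i: group_hom K quotient_group "\<lambda>x. x"
    by unfold_locales (auto simp: hom_def K_def)
  have cK: "carrier K = S" and oK: "\<one>\<^bsub>K\<^esub> = \<one>\<^bsub>quotient_group\<^esub>" by (auto simp: K_def)
  have "bounding_law K (order G)"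
    unfolding bounding_law_def
  proof (intro allI impI)
    fix a and x :: "nat \<Rightarrow> 'b" and y :: "nat \<times> nat \<Rightarrow> 'b"
    assume *: "a \<in> carrier K" "range x \<subseteq> carrier K" "range y \<subseteq> carrier K"
    then have "a \<in> carrier quotient_group" "range x \<subseteq> carrier quotient_group" "range y \<subseteq> carrier quotient_group"
      using S.subset by (auto simp: cK)
    then show "iterated_commutator K a x y (index_pairs (order G)) = \<one>\<^bsub>K\<^esub>"
      using i.iterated_commutator_hom[OF *, of "index_pairs (order G)"] bounding_law_quotient[OF len]
      unfolding bounding_law_def by (simp add: comp_def oK)
  qed
  moreover have "x [^]\<^bsub>K\<^esub> Suc k = \<one>\<^bsub>K\<^esub>" if "x \<in> carrier K" for x
    using i.hom_nat_pow[OF that, of "Suc k"] quotient_pow[of x] that S.subset by (auto simp: cK oK)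
  moreover have "finite (carrier K)" using finite_quotient(1) S.subset by (auto simp: cK intro: finite_subset)
  moreover have "carrier K \<noteq> {\<one>\<^bsub>K\<^esub>}" using S(2) by (simp add: cK oK)
  ultimately obtain N where N: "subgroup N K" "N \<noteq> carrier K" "order K \<le> max (order G) (Suc k) * card N"
    using K.exists_subgroup_of_bounded_index[of "order G" "Suc k"] by blast
  have "subgroup N quotient_group" using N(1) unfolding K_def by (metis Q.incl_subgroup S(1))
  moreover have "N \<subset> S" using N(1,2) subgroup.subset[OF N(1)] by (auto simp: cK)
  moreover have "max (order G) (Suc k) = Suc k" using k by simp
  ultimately show ?thesis using N(3) by (auto simp: order_def cK)
qed

text \<open>In G the relations s t = \<open>nf\<close> (s t) imply h = 1: an assignment satisfying
  them extends to a homomorphism, which kills h. This quasi-identity is short enough to transfer to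
  the quotient group, where the letters themselves satisfy the relations.\<close>

lemma quotient_separated:
  assumes law: "law_length k (order G) \<le> l"
    and len: "\<And>r. 2 ^ r \<le> card (carrier B) \<Longrightarrow> relation_factor k * r ^ 3 \<le> l"
    and h: "h \<in> carrier quotient_group" and killed: "\<And>\<phi>. \<phi> \<in> hom quotient_group G \<Longrightarrow> \<phi> h = \<one>"
  shows "h = \<one>\<^bsub>quotient_group\<^esub>"
proof (rule ccontr)
  assume neq: "h \<noteq> \<one>\<^bsub>quotient_group\<^esub>"
  obtain X nf r where nf: "normal_forms quotient_group G (carrier quotient_group) X nf r"
    and X: "finite X" "card X \<le> Suc k * r" and r: "2 ^ r \<le> card (carrier quotient_group)"
    using Q.exists_normal_forms[OF finite_quotient(1) is_group quotient_chain[OF law] Q.subgroup_self] by blast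
  let ?H = "quotient_group"
  have XH: "X \<subseteq> carrier ?H" and nf_len: "\<And>x. x \<in> carrier ?H \<Longrightarrow> length (nf x) \<le> r"
    and nf_set: "\<And>x. x \<in> carrier ?H \<Longrightarrow> set (nf x) \<subseteq> X"
    and nf_val: "\<And>x. x \<in> carrier ?H \<Longrightarrow> word_value ?H (\<lambda>x. x) (nf x) = x"
    and nf_hom: "\<And>f x y. f ` X \<subseteq> carrier G \<Longrightarrow>
        (\<forall>s\<in>X. \<forall>t\<in>X. f s \<otimes> f t = word_value G f (nf (s \<otimes>\<^bsub>?H\<^esub> t))) \<Longrightarrow>
        x \<in> carrier ?H \<Longrightarrow> y \<in> carrier ?H \<Longrightarrow>
        word_value G f (nf (x \<otimes>\<^bsub>?H\<^esub> y)) = word_value G f (nf x) \<otimes> word_value G f (nf y)"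
    using nf unfolding normal_forms_def by blast+
  \<comment> \<open>That h is nontrivial makes r positive, as the estimates require, and provides a
    letter for the trailing power in \<open>word_term\<close>.\<close>
  have "nf h \<noteq> []" using nf_val[OF h] neq by auto
  then have r1: "r \<ge> 1" using nf_len[OF h] by (cases "nf h") auto
  obtain s0 where s0: "s0 \<in> X" using \<open>nf h \<noteq> []\<close> nf_set[OF h] by (cases "nf h") auto
  obtain xs where xs: "set xs = X" "length xs = card X"
    using X(1) by (metis finite_distinct_list distinct_card)
  define wt where "wt x = word_term k s0 (nf x)" for x
  define ps where "ps = map (\<lambda>(s, t). (Mult (Var s) (Var t), wt (s \<otimes>\<^bsub>?H\<^esub> t))) (List.product xs xs)"
  have ps: "(u, v) \<in> set ps \<longleftrightarrow> (\<exists>s\<in>X. \<exists>t\<in>X. u = Mult (Var s) (Var t) \<and> v = wt (s \<otimes>\<^bsub>?H\<^esub> t))" for u v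
    by (auto simp: ps_def xs)
  \<comment> \<open>The tautological assignment of letters to themselves, made total by the value
    1.\<close>
  define f where "f x = (if x \<in> carrier ?H then x else \<one>\<^bsub>?H\<^esub>)" for x
  have f: "range f \<subseteq> carrier ?H" by (auto simp: f_def)
  have f_wt: "group_value ?H f (wt x) = x" if x: "x \<in> carrier ?H" for x
  proof -
    have "group_value ?H f (wt x) = word_value ?H f (nf x)"
      unfolding wt_def by (rule Q.group_value_word_term[OF f quotient_pow])
    also have "\<dots> = word_value ?H (\<lambda>x. x) (nf x)"
      using nf_set[OF x] XH by (intro word_value_cong) (auto simp: f_def)
    finally show ?thesis using nf_val[OF x] by simp
  qed
  have wt_len: "term_length (wt x) \<le> 2 * r + 2 * k + 1" if "x \<in> carrier ?H" for x
    using nf_len[OF that] by (simp add: wt_def term_length_word_term)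
  have H_mult: "s \<otimes>\<^bsub>?H\<^esub> t \<in> carrier ?H" if "s \<in> X" "t \<in> X" for s t using that XH by auto
  have "group_value ?H f (Mult (wt h) (wt h)) = group_value ?H f (wt h)"
  proof (rule quasi_identity_transfer[of ps _ _ f])
    fix s t assume "(s, t) \<in> set ps"
    then show "meet_free s \<and> meet_free t" by (auto simp: ps wt_def meet_free_word_term)
  next
    show "set_sr_term (Mult (wt h) (wt h)) \<union> set_sr_term (wt h) \<subseteq> (\<Union>(s, t)\<in>set ps. set_sr_term s)"
    proof
      fix x assume "x \<in> set_sr_term (Mult (wt h) (wt h)) \<union> set_sr_term (wt h)"
      then have "x \<in> X" using nf_set[OF h] s0 by (auto simp: wt_def set_word_term)
      then have "(Mult (Var x) (Var x), wt (x \<otimes>\<^bsub>?H\<^esub> x)) \<in> set ps" by (auto simp: ps)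
      then show "x \<in> (\<Union>(s, t)\<in>set ps. set_sr_term s)" by force
    qed
  next
    fix g :: "'b \<Rightarrow> 'a"
    assume g: "range g \<subseteq> carrier G" and rel: "\<And>s t. (s, t) \<in> set ps \<Longrightarrow> group_value G g s = group_value G g t"
    have g_wt: "group_value G g (wt x) = word_value G g (nf x)" for x
      unfolding wt_def by (rule group_value_word_term[OF g pow_G])
    have gX: "g ` X \<subseteq> carrier G" using g by blast
    have rels: "\<forall>s\<in>X. \<forall>t\<in>X. g s \<otimes> g t = word_value G g (nf (s \<otimes>\<^bsub>?H\<^esub> t))"
    proof (intro ballI)
      fix s t assume "s \<in> X" "t \<in> X"
      then have "(Mult (Var s) (Var t), wt (s \<otimes>\<^bsub>?H\<^esub> t)) \<in> set ps" by (auto simp: ps)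
      from rel[OF this] show "g s \<otimes> g t = word_value G g (nf (s \<otimes>\<^bsub>?H\<^esub> t))" by (simp add: g_wt)
    qed
    have "(\<lambda>x. word_value G g (nf x)) \<in> hom ?H G"
      using g by (intro homI nf_hom[OF gX rels] word_value_closed) auto
    then have "word_value G g (nf h) = \<one>" by (rule killed)
    then show "group_value G g (Mult (wt h) (wt h)) = group_value G g (wt h)" by (simp add: g_wt)
  next
    fix s t assume "(s, t) \<in> set ps"
    then obtain a b where ab: "a \<in> X" "b \<in> X" "s = Mult (Var a) (Var b)" "t = wt (a \<otimes>\<^bsub>?H\<^esub> b)"
      by (auto simp: ps)
    then show "group_value ?H f s = group_value ?H f t"
      using f_wt[OF H_mult[OF ab(1,2)]] XH by (auto simp: f_def)
  next
    define M where "M = map (\<lambda>(s, t). Meet s t) ps"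
    \<comment> \<open>Cost of one premise: 1 for the meet, 3 for the product of two letters and at
      most 2 r + 2 k + 1 for the word; the guard repeats this \<open>Suc k\<close> times.\<close>
    define c where "c = Suc k * (2 * r + 2 * k + 6) + 2"
    have "(\<Sum>s\<leftarrow>M. Suc k * (term_length s + 1) + 2) \<le> (\<Sum>s\<leftarrow>M. c)"
    proof (rule sum_list_mono)
      fix s assume "s \<in> set M"
      then obtain a b where ab: "a \<in> X" "b \<in> X" "s = Meet (Mult (Var a) (Var b)) (wt (a \<otimes>\<^bsub>?H\<^esub> b))"
        by (auto simp: M_def ps)
      have len_s: "term_length s + 1 \<le> 2 * r + 2 * k + 6" using wt_len[OF H_mult[OF ab(1,2)]] ab(3) by simp
      then show "Suc k * (term_length s + 1) + 2 \<le> c"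
        using mult_le_mono2[OF len_s, of "Suc k"] by (simp add: c_def del: mult_Suc)
    qed
    also have "\<dots> = length M * c" by (simp add: sum_list_triv)
    also have "length M = card X * card X" by (simp add: M_def ps_def xs)
    finally have 1: "(\<Sum>s\<leftarrow>M. Suc k * (term_length s + 1) + 2) \<le> card X * card X * c" .
    have "card X * card X \<le> (Suc k * r) * (Suc k * r)" using X(2) by (intro mult_le_mono)
    moreover have rr: "x \<le> x * r" for x using r1 by simp
    have "c \<le> (Suc k * (2 * k + 8) + 2) * r"
    proof -
      have "2 * r + 2 * k + 6 \<le> (2 * k + 8) * r" using rr[of "2 * k + 6"] by (simp add: algebra_simps)
      then have "Suc k * (2 * r + 2 * k + 6) \<le> Suc k * ((2 * k + 8) * r)" by (rule mult_le_mono2)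
      then show ?thesis unfolding c_def using r1 by (simp add: algebra_simps)
    qed
    ultimately have "card X * card X * c \<le> (Suc k * r) * (Suc k * r) * ((Suc k * (2 * k + 8) + 2) * r)"
      by (rule mult_le_mono)
    also have "\<dots> = Suc k ^ 2 * (Suc k * (2 * k + 8) + 2) * r ^ 3"
      by (simp add: power2_eq_square power3_eq_cube algebra_simps)
    finally have 2: "card X * card X * c \<le> Suc k ^ 2 * (Suc k * (2 * k + 8) + 2) * r ^ 3" .
    have r3: "x \<le> x * r ^ 3" for x using r1 by simp
    have "term_length (Meet (Mult (wt h) (wt h)) (wt h)) + 1 \<le> 6 * r + 6 * k + 6"
      using wt_len[OF h] by simp
    also have "\<dots> \<le> (6 * k + 12) * r" using rr[of "6 * k + 6"] by (simp add: algebra_simps)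
    also have "\<dots> \<le> (6 * k + 12) * r ^ 3" using r1 by (intro mult_le_mono2) (simp add: self_le_power)
    finally have 3: "Suc k * (term_length (Meet (Mult (wt h) (wt h)) (wt h)) + 1) \<le> Suc k * ((6 * k + 12) * r ^ 3)"
      by (rule mult_le_mono2)
    have arith: "2 * (1 + a) + b + 2 \<le> 2 * A + 4 + B'" if "a \<le> A" "b \<le> B'" for a b A B' :: nat
      using that by simp
    have "horn_length k M (Meet (Mult (wt h) (wt h)) (wt h)) \<le>
        2 * (Suc k ^ 2 * (Suc k * (2 * k + 8) + 2) * r ^ 3) + 4 + Suc k * ((6 * k + 12) * r ^ 3)"
      unfolding horn_length_eq by (rule arith[OF le_trans[OF 1 2] 3])
    also have "\<dots> \<le> relation_factor k * r ^ 3"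
      using r3[of 4] by (simp add: relation_factor_def algebra_simps)
    also have "\<dots> \<le> l" using len[of r] r finite_quotient(2) by simp
    finally show "horn_length k (map (\<lambda>(s, t). Meet s t) ps) (Meet (Mult (wt h) (wt h)) (wt h)) \<le> l"
      by (simp add: M_def)
  qed (use f in \<open>auto simp: wt_def meet_free_word_term\<close>)
  then have "h \<otimes>\<^bsub>?H\<^esub> h = h" using f_wt[OF h] by simp
  then show False using h neq by simp
qed

end

section \<open>The cubic logarithmic bound\<close>

theorem mainTheorem3:
  fixes G :: "('a, 'm) monoid_scheme"
  assumes "group G" and "finite (carrier G)"
  shows "additive_idempotent_semiring (flat_extension G) \<and>
    ((\<exists>p P. sylow_subgroup p P G \<and> \<not> comm_group (G\<lparr>carrier := P\<rparr>)) \<longrightarrow>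
      (\<lambda>n. real (eq_complexity (flat_extension G) n)) \<in> O(\<lambda>n. (log 2 (real n)) ^ 3))"
proof -
  interpret group G by fact
  define k where "k = 2 * order G - 1"
  have "order G > 0" using assms(2) by (simp add: order_gt_0_iff_finite)
  then have k: "Suc k = 2 * order G" by (simp add: k_def)
  \<comment> \<open>All length requirements are charged to one constant; as log 2 n \<ge> 1 for n
    \<ge> 2, those independent of n are covered as well.\<close>
  define C where "C = base_length k + law_length k (order G) + relation_factor k"
  have bound: "real (eq_complexity (flat_extension G) n) \<le> real C * log 2 (real n) ^ 3" if n: "n \<ge> 2" for n
  proof -
    define L where "L = log 2 (real n)"
    have L1: "L \<ge> 1" using n by (simp add: L_def le_log_iff)
    define l where "l = nat \<lfloor>real C * L ^ 3\<rfloor>"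
    have below: "x \<le> l" if "real x \<le> real C * L ^ 3" for x
      using that unfolding l_def by (simp add: le_nat_floor)
    have "1 \<le> L ^ 3" using L1 by (rule one_le_power)
    then have "real C * 1 \<le> real C * L ^ 3" by (intro mult_left_mono) auto
    then have Cl: "C \<le> l" by (intro below) simp
    have "\<exists>u v :: nat sr_term. satisfies (flat_extension G) u v \<and> \<not> satisfies B u v \<and> equation_length u v \<le> l"
      if B: "is_alg B" "finite (carrier B)" "card (carrier B) < n" "\<not> in_variety (flat_extension G) B"
      for B :: "nat sr_alg"
    proof (rule ccontr)
      assume "\<not> ?thesis"
      then have eqs: "equations_up_to (flat_extension G) l B" unfolding equations_up_to_def by blast
      have model: "flat_model G B l k p" if "p \<in> carrier B" for p
        using B eqs Cl k assms(2) that by unfold_locales (auto simp: C_def)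
      have len: "relation_factor k * r ^ 3 \<le> l" if r: "2 ^ r \<le> card (carrier B)" for r
      proof (rule below)
        have "(2::nat) ^ r \<le> n" using r B(3) by simp
        then have "real (2 ^ r) \<le> real n" by (rule of_nat_mono)
        then have "real r \<le> L" unfolding L_def using n by (simp add: le_log_iff powr_realpow)
        then have "real r ^ 3 \<le> L ^ 3" by (intro power_mono) auto
        then have "real (relation_factor k) * real r ^ 3 \<le> real C * L ^ 3"
          by (intro mult_mono) (auto simp: C_def)
        then show "real (relation_factor k * r ^ 3) \<le> real C * L ^ 3" by simp
      qed
      \<comment> \<open>An equation is split into two inequalities, each treated at its own point p,
        the value of the smaller side; commutativity of meet then gives equality.\<close>
      have le: "sr_meet B (eval_term B e u) (eval_term B e v) = eval_term B e u"
        if "satisfies (flat_extension G) u v" "range e \<subseteq> carrier B" for e and u v :: "nat sr_term"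
      proof -
        define p where "p = eval_term B e u"
        have p: "p \<in> carrier B" unfolding p_def using that(2) by (intro eval_term_closed[OF B(1)]) auto
        interpret flat_model G B l k p by (rule model[OF p])
        have "sr_meet B p (eval_term B e v) = p"
          using that Cl by (intro meet_eq_if_separated[OF _ _ p_def] quotient_separated len) (auto simp: C_def)
        then show ?thesis by (simp add: p_def)
      qed
      have "satisfies B u v" if uv: "satisfies (flat_extension G) u v" for u v :: "nat sr_term"
        unfolding satisfies_def
      proof (intro allI impI)
        fix e :: "nat \<Rightarrow> nat" assume e: "range e \<subseteq> carrier B"
        have c: "eval_term B e t \<in> carrier B" for t :: "nat sr_term"
          using e by (intro eval_term_closed[OF B(1)]) auto
        interpret flat_model G B l k "eval_term B e u" by (rule model[OF c])
        have "satisfies (flat_extension G) v u" using uv by (simp add: satisfies_def)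
        then show "eval_term B e u = eval_term B e v"
          using le[OF uv e] le[of v u e] e meet_commute[OF c c, of u v] by simp
      qed
      then have "in_variety (flat_extension G) B"
        by (intro in_variety_if_satisfies is_alg_flat B(1))
      then show False using B(4) by simp
    qed
    then have "eq_complexity (flat_extension G) n \<le> l"
      unfolding eq_complexity_def by (intro Least_le) blast
    then have "real (eq_complexity (flat_extension G) n) \<le> real l" by simp
    also have "real l \<le> real C * L ^ 3" unfolding l_def using L1 by (simp add: of_nat_floor)
    finally show ?thesis by (simp add: L_def)
  qed
  have "(\<lambda>n. real (eq_complexity (flat_extension G) n)) \<in> O(\<lambda>n. (log 2 (real n)) ^ 3)"
  proof (rule bigoI)
    show "\<forall>\<^sub>F n in at_top. norm (real (eq_complexity (flat_extension G) n)) \<le> real C * norm (log 2 (real n) ^ 3)"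
    proof (rule eventually_mono[OF eventually_ge_at_top[of 2]])
      fix n :: nat assume n: "2 \<le> n"
      then have "0 \<le> log 2 (real n)" by simp
      then show "norm (real (eq_complexity (flat_extension G) n)) \<le> real C * norm (log 2 (real n) ^ 3)"
        using bound[OF n] by simp
    qed
  qed
  then show ?thesis using additive_idempotent_semiring_flat by blast
qed

end
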